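(* Let $L=2$. Suppose that, as $b\to\infty$, the weight $\rho_1=\rho_1(b)\in(0,1)$ of the WD-CuSum algorithm satisfies $\rho_1\to0$ and $\frac{\log\rho_1}{b}\to0$, and the transient duration $d_1=d_1(b)\to\infty$ satisfies $d_1\sim c_1'\frac{b}{I_1}$ for some constant $c_1'\in[0,\infty]$. Let $\widetilde\tau(b)$ and $\widehat\tau(b)$ be the WD-CuSum and D-CuSum stopping times with threshold $b$. (i) If $c_1'>1$, then as $b\to\infty$, $$J^{d_1}_{\mathrm L}(\widetilde\tau(b))=J^{d_1}_{\mathrm P}(\widetilde\tau(b))\le\frac{b}{I_1}(1+o(1)),\qquad J^{d_1}_{\mathrm L}(\widehat\tau(b))=J^{d_1}_{\mathrm P}(\widehat\tau(b))\le\frac{b}{I_1}(1+o(1)).$$ (ii) If $c_1'\le1$, then as $b\to\infty$, $$J^{d_1}_{\mathrm L}(\widetilde\tau(b))=J^{d_1}_{\mathrm P}(\widetilde\tau(b))\le b\left(\frac{c_1'}{I_1}+\frac{1-c_1'}{I_2}\right)(1+o(1)),$$ $$J^{d_1}_{\mathrm L}(\widehat\tau(b))=J^{d_1}_{\mathrm P}(\widehat\tau(b))\le b\left(\frac{c_1'}{I_1}+\frac{1-c_1'}{I_2}\right)(1+o(1)).$$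
   Context: Model ($L=2$). $f_0,f_1,f_2$ are known probability densities with respect to a common measure, and $I_i=\int f_i\log\frac{f_i}{f_0}$, $i=1,2$, are assumed positive and finite. Independent random variables $X_1,X_2,\dots$ are observed sequentially. For a change-point $v_1\ge1$ and transient duration $d_1$ (a nonnegative integer), under $\mathbb{P}^{d_1}_{v_1}$ (expectation $\mathbb{E}^{d_1}_{v_1}$) the $X_k$ are independent with $X_k\sim f_0$ for $k<v_1$, $X_k\sim f_1$ for $v_1\le k<v_1+d_1$, and $X_k\sim f_2$ for $k\ge v_1+d_1$. Worst-case average detection delays of a stopping time $\tau$ (with respect to $\mathcal F_k=\sigma(X_1,\dots,X_k)$): $J^{d_1}_{\mathrm P}(\tau)=\sup_{v_1\ge1}\mathbb{E}^{d_1}_{v_1}[\tau-v_1\mid\tau\ge v_1]$ (Pollak) and $J^{d_1}_{\mathrm L}(\tau)=\sup_{v_1\ge1}\operatorname{ess\,sup}\mathbb{E}^{d_1}_{v_1}[(\tau-v_1)^+\mid X_1,\dots,X_{v_1-1}]$ (Lorden). D-CuSum: with $b>0$, $\widehat\tau(b)=\inf\{k\ge1:\widehat W[k]>b\}$, where (empty products equal $1$) $$\widehat W[k]=\max_{1\le v_1\le k}\ \max_{v_1\le v_2\le k+1}\log\left(\prod_{j=v_1}^{v_2-1}\frac{f_1(X_j)}{f_0(X_j)}\prod_{j=v_2}^{k}\frac{f_2(X_j)}{f_0(X_j)}\right).$$ WD-CuSum: with weight $\rho_1\in(0,1)$ and $b>0$, $\widetilde\tau(b)=\inf\{k\ge1:\widetilde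 W[k]\ge b\}$, where $$(\widetilde W[k])^+=\max_{1\le v_1\le v_2\le k+1}\log\left(\rho_1^{\mathbf 1\{k\ge v_2\}}\prod_{j=v_1}^{v_2-1}\frac{(1-\rho_1)f_1(X_j)}{f_0(X_j)}\prod_{j=v_2}^{k}\frac{f_2(X_j)}{f_0(X_j)}\right);$$ since $b>0$, $\widetilde W[k]$ may be replaced by its positive part $(\widetilde W[k])^+$. Convention: $d_1\sim c_1' b/I_1$ means $d_1I_1/b\to c_1'$ (with $c_1'=0$ meaning $d_1=o(b)$ and $c_1'=\infty$ meaning $b=o(d_1)$). *)

theory Defs
  imports "HOL-Probability.Probability"
begin

definition info_number :: "'a measure \<Rightarrow> ('a \<Rightarrow> real) \<Rightarrow> ('a \<Rightarrow> real) \<Rightarrow> real" where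
  "info_number \<mu> f g = (\<integral>x. f x * ln (f x / g x) \<partial>\<mu>)"

text \<open>The density of the observation at time \<open>k\<close> when the change happens at time \<open>v\<close> and the
  transient phase lasts \<open>d\<close> time units.\<close>

definition obs_density ::
    "('a \<Rightarrow> real) \<Rightarrow> ('a \<Rightarrow> real) \<Rightarrow> ('a \<Rightarrow> real) \<Rightarrow> nat \<Rightarrow> nat \<Rightarrow> nat \<Rightarrow> 'a \<Rightarrow> real" where
  "obs_density f0 f1 f2 d v k = (if k < v then f0 else if k < v + d then f1 else f2)"

text \<open>\<open>P d v\<close> is the law with transient duration \<open>d\<close> and change-point \<open>v \<ge> 1\<close>; all these laws live on
  the same measurable space, given by \<open>\<Omega>\<close>, of which only \<open>space\<close> and \<open>sets\<close> matter.
  The assumptions \<open>abs_cont\<close> and \<open>integrable_info\<close> together express that the divergence of \<open>f1\<close> (resp.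
  \<open>f2\<close>) from \<open>f0\<close> is finite: an integrand \<open>f x * ln (f x / 0)\<close> with \<open>f x > 0\<close> counts as infinite,
  and the negative part of the integrand is always integrable. In particular the
  observations with \<open>f0 (X k) = 0\<close>, for which the likelihood ratios below are a division by zero,
  have probability zero under every \<open>P d v\<close>.\<close>

locale transient_change_model =
  fixes \<Omega> :: "'w measure"
    and \<mu> :: "'a measure"
    and f0 f1 f2 :: "'a \<Rightarrow> real"
    and P :: "nat \<Rightarrow> nat \<Rightarrow> 'w measure"
    and X :: "nat \<Rightarrow> 'w \<Rightarrow> 'a"
  assumes measurable_densities:
      "\<And>f. f \<in> {f0, f1, f2} \<Longrightarrow> f \<in> borel_measurable \<mu>"
    and nonneg_densities:
      "\<And>f x. f \<in> {f0, f1, f2} \<Longrightarrow> x \<in> space \<mu> \<Longrightarrow> 0 \<le> f x"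
    and normalized_densities:
      "\<And>f. f \<in> {f0, f1, f2} \<Longrightarrow> (\<integral>\<^sup>+x. ennreal (f x) \<partial>\<mu>) = 1"
    and abs_cont:
      "\<And>f. f \<in> {f1, f2} \<Longrightarrow> (AE x in \<mu>. f0 x = 0 \<longrightarrow> f x = 0)"
    and integrable_info:
      "\<And>f. f \<in> {f1, f2} \<Longrightarrow> integrable \<mu> (\<lambda>x. f x * ln (f x / f0 x))"
    and info_pos:
      "\<And>f. f \<in> {f1, f2} \<Longrightarrow> 0 < info_number \<mu> f f0"
    and prob:
      "\<And>d v. 1 \<le> v \<Longrightarrow> prob_space (P d v)"
    and sets_P:
      "\<And>d v. 1 \<le> v \<Longrightarrow> sets (P d v) = sets \<Omega>"
    and indep:
      "\<And>d v. 1 \<le> v \<Longrightarrow> prob_space.indep_vars (P d v) (\<lambda>_. \<mu>) X {1..}"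
    and law:
      "\<And>d v k. 1 \<le> v \<Longrightarrow> 1 \<le> k \<Longrightarrow>
        distributed (P d v) \<mu> (X k) (\<lambda>x. ennreal (obs_density f0 f1 f2 d v k x))"

text \<open>The \<open>\<sigma>\<close>-algebra generated by \<open>X 1, \<dots>, X n\<close> (the trivial one for \<open>n = 0\<close>).\<close>

definition obs_algebra :: "'w set \<Rightarrow> 'a measure \<Rightarrow> (nat \<Rightarrow> 'w \<Rightarrow> 'a) \<Rightarrow> nat \<Rightarrow> 'w measure" where
  "obs_algebra S \<mu> X n = vimage_algebra S (\<lambda>\<omega>. \<lambda>k\<in>{1..n}. X k \<omega>) (PiM {1..n} (\<lambda>_. \<mu>))"

text \<open>In the two delay functionals, \<open>Q v\<close> is the law with change-point \<open>v\<close>. Subtraction on \<open>enat\<close> is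
  truncated at \<open>0\<close>, and \<open>\<infinity> - v = \<infinity>\<close>, so \<open>\<tau> - v\<close> is the positive part. Change-points \<open>v\<close> for which the
  conditioning event has probability zero contribute \<open>0\<close> to the first supremum.\<close>

definition pollak_delay :: "(nat \<Rightarrow> 'w measure) \<Rightarrow> ('w \<Rightarrow> enat) \<Rightarrow> ennreal" where
  "pollak_delay Q \<tau> =
    (SUP v\<in>{1..}. \<integral>\<^sup>+\<omega>. ennreal_of_enat (\<tau> \<omega> - enat v)
        \<partial>uniform_measure (Q v) {\<omega> \<in> space (Q v). enat v \<le> \<tau> \<omega>})"

definition lorden_delay ::
    "'a measure \<Rightarrow> (nat \<Rightarrow> 'w \<Rightarrow> 'a) \<Rightarrow> (nat \<Rightarrow> 'w measure) \<Rightarrow> ('w \<Rightarrow> enat) \<Rightarrow> ennreal" where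
  "lorden_delay \<mu> X Q \<tau> =
    (SUP v\<in>{1..}. esssup (Q v)
        (nn_cond_exp (Q v) (obs_algebra (space (Q v)) \<mu> X (v - 1))
          (\<lambda>\<omega>. ennreal_of_enat (\<tau> \<omega> - enat v))))"

text \<open>Logarithm of a nonnegative real with \<open>log 0 = - \<infinity>\<close> (whereas \<open>ln 0 = 0\<close> on type \<open>real\<close>).\<close>

definition elog :: "real \<Rightarrow> ereal" where
  "elog x = (if x \<le> 0 then - \<infinity> else ereal (ln x))"

text \<open>Both statistics are functions of an observed path \<open>x\<close>, indexed from \<open>1\<close>, and of \<open>k \<ge> 1\<close>.\<close>

definition dcusum_stat ::
    "('a \<Rightarrow> real) \<Rightarrow> ('a \<Rightarrow> real) \<Rightarrow> ('a \<Rightarrow> real) \<Rightarrow> (nat \<Rightarrow> 'a) \<Rightarrow> nat \<Rightarrow> ereal" where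
  "dcusum_stat f0 f1 f2 x k =
    (MAX v1\<in>{1..k}. MAX v2\<in>{v1..k + 1}.
      elog ((\<Prod>j\<in>{v1..<v2}. f1 (x j) / f0 (x j)) * (\<Prod>j\<in>{v2..k}. f2 (x j) / f0 (x j))))"

definition dcusum_time ::
    "('a \<Rightarrow> real) \<Rightarrow> ('a \<Rightarrow> real) \<Rightarrow> ('a \<Rightarrow> real) \<Rightarrow> (nat \<Rightarrow> 'w \<Rightarrow> 'a) \<Rightarrow> real \<Rightarrow> 'w \<Rightarrow> enat" where
  "dcusum_time f0 f1 f2 X b \<omega> =
    (INF k\<in>{k. 1 \<le> k \<and> dcusum_stat f0 f1 f2 (\<lambda>j. X j \<omega>) k > ereal b}. enat k)"

text \<open>The positive part of the WD-CuSum statistic with weight \<open>\<rho>\<close>: the index pair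
  \<open>v1 = v2 = k + 1\<close> contributes \<open>0\<close>.\<close>

definition wdcusum_stat_pos ::
    "('a \<Rightarrow> real) \<Rightarrow> ('a \<Rightarrow> real) \<Rightarrow> ('a \<Rightarrow> real) \<Rightarrow> real \<Rightarrow> (nat \<Rightarrow> 'a) \<Rightarrow> nat \<Rightarrow> ereal" where
  "wdcusum_stat_pos f0 f1 f2 \<rho> x k =
    (MAX (v1, v2)\<in>{(v1, v2). 1 \<le> v1 \<and> v1 \<le> v2 \<and> v2 \<le> k + 1}.
      elog (\<rho> ^ (if v2 \<le> k then 1 else 0)
        * (\<Prod>j\<in>{v1..<v2}. (1 - \<rho>) * f1 (x j) / f0 (x j))
        * (\<Prod>j\<in>{v2..k}. f2 (x j) / f0 (x j))))"

definition wdcusum_time ::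
    "('a \<Rightarrow> real) \<Rightarrow> ('a \<Rightarrow> real) \<Rightarrow> ('a \<Rightarrow> real) \<Rightarrow> real \<Rightarrow> (nat \<Rightarrow> 'w \<Rightarrow> 'a) \<Rightarrow> real \<Rightarrow> 'w \<Rightarrow> enat" where
  "wdcusum_time f0 f1 f2 \<rho> X b \<omega> =
    (INF k\<in>{k. 1 \<le> k \<and> wdcusum_stat_pos f0 f1 f2 \<rho> (\<lambda>j. X j \<omega>) k \<ge> ereal b}. enat k)"

text \<open>\<open>J b \<le> g b * (1 + o(1))\<close> as \<open>b \<rightarrow> \<infinity>\<close>.\<close>

definition asymp_upper_bound :: "(real \<Rightarrow> ennreal) \<Rightarrow> (real \<Rightarrow> real) \<Rightarrow> bool" where
  "asymp_upper_bound J g \<longleftrightarrow>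
    (\<exists>\<epsilon>. (\<epsilon> \<longlongrightarrow> 0) at_top \<and> (\<forall>\<^sub>F b in at_top. J b \<le> ennreal (g b * (1 + \<epsilon> b))))"

end

theory Submission
  imports Defs
begin

text \<open>
  Both statistics maximise over the change-point, so restarting the procedure at any time can only
  delay the alarm. Hence, whatever the past, the delay after a change at \<open>v\<close> is dominated by that of
  the procedure started at \<open>v\<close>, which is independent of the past and distributed as for \<open>v = 1\<close>:
  both worst-case delays are attained at \<open>v = 1\<close> and equal the mean of \<open>\<tau> - 1\<close> there.

  For \<open>v = 1\<close>, an alarm after time \<open>n\<close> forces the log-likelihood ratio \<open>S n\<close> of the true model to be
  below \<open>b\<close> (plus \<open>o(b)\<close> and a small multiple of \<open>n\<close> for the weights). The log-likelihood ratios have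
  exponential moments on the negative side, so Chernoff's bound gives, for small \<open>s > 0\<close>, an exponential
  decay of this probability with rate \<open>s\<close> times the excess over \<open>b\<close> of (almost) the mean of \<open>S n\<close>.
  Summing over \<open>n\<close>, the mean delay is at most the time at which the mean of \<open>S n\<close> crosses \<open>b\<close>, plus a
  constant.
\<close>

declare One_nat_def [simp del]

subsection \<open>First alarms and the worst change-point\<close>

text \<open>A functional of the path rather than of the sample point, so that shifted and restricted
  paths can be inserted. Without an alarm the infimum is over the empty set and equals
  \<open>\<infinity>\<close>.\<close>

definition first_time :: "(nat \<Rightarrow> (nat \<Rightarrow> 'a) \<Rightarrow> bool) \<Rightarrow> (nat \<Rightarrow> 'a) \<Rightarrow> enat" where
  "first_time A x = (INF k\<in>{k. 1 \<le> k \<and> A k x}. enat k)"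

lemma le_first_time_iff: "enat v \<le> first_time A x \<longleftrightarrow> (\<forall>k. 1 \<le> k \<and> k < v \<longrightarrow> \<not> A k x)"
  unfolding first_time_def le_INF_iff by (auto simp: not_less dest: leD)

lemma first_time_le: "1 \<le> k \<Longrightarrow> A k x \<Longrightarrow> first_time A x \<le> enat k"
  unfolding first_time_def by (rule INF_lower) auto

text \<open>The event \<open>enat v \<le> first_time A (Y \<omega>)\<close> involves only finitely
  many alarms, every level set is a countable combination of such events, and \<open>enat\<close> is
  countable.\<close>

lemma measurable_first_time:
  assumes "\<And>k. 1 \<le> k \<Longrightarrow> Measurable.pred M (\<lambda>\<omega>. A k (Y \<omega>))"
  shows "(\<lambda>\<omega>. first_time A (Y \<omega>)) \<in> measurable M (count_space UNIV)"
proof -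
  have ge [measurable]: "Measurable.pred M (\<lambda>\<omega>. enat v \<le> first_time A (Y \<omega>))" for v
  proof -
    have "(\<lambda>\<omega>. enat v \<le> first_time A (Y \<omega>)) = (\<lambda>\<omega>. \<forall>k\<in>{1..<v}. \<not> A k (Y \<omega>))"
      by (auto simp: le_first_time_iff fun_eq_iff)
    also have "Measurable.pred M \<dots>"
      using assms by (intro pred_intros_finite) auto
    finally show ?thesis .
  qed
  have "Measurable.pred M (\<lambda>\<omega>. first_time A (Y \<omega>) = e)" for e
  proof (cases e)
    case (enat n)
    have "(\<lambda>\<omega>. first_time A (Y \<omega>) = e) =
      (\<lambda>\<omega>. enat n \<le> first_time A (Y \<omega>) \<and> \<not> enat (Suc n) \<le> first_time A (Y \<omega>))"
      unfolding enat by (auto simp: fun_eq_iff Suc_ile_eq)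
    then show ?thesis by simp
  next
    case infinity
    have "e' = \<infinity> \<longleftrightarrow> (\<forall>n. enat n \<le> e')" for e'
      by (cases e') (auto simp: not_le)
    then have "(\<lambda>\<omega>. first_time A (Y \<omega>) = e) = (\<lambda>\<omega>. \<forall>n. enat n \<le> first_time A (Y \<omega>))"
      unfolding infinity by auto
    then show ?thesis by simp
  qed
  then have "(\<lambda>\<omega>. first_time A (Y \<omega>)) -` {e} \<inter> space M \<in> sets M" for e
    by (simp add: vimage_def pred_def Int_def conj_commute)
  then show ?thesis
    by (auto simp: measurable_count_space_eq2_countable)
qed

text \<open>In \<open>shift\<close>, restarting the procedure after time \<open>m\<close> can only delay the alarm: this is what makes
  \<open>v = 1\<close> the worst change-point.\<close>

locale alarm_rule =
  fixes \<mu> :: "'a measure" and A :: "nat \<Rightarrow> (nat \<Rightarrow> 'a) \<Rightarrow> bool"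
  assumes meas: "1 \<le> k \<Longrightarrow> Measurable.pred (PiM {1..k} (\<lambda>_. \<mu>)) (A k)"
    and local: "1 \<le> k \<Longrightarrow> A k (restrict x {1..k}) = A k x"
    and shift: "1 \<le> k \<Longrightarrow> A k (\<lambda>j. x (j + m)) \<Longrightarrow> A (k + m) x"
begin

lemma restrict_eq: "1 \<le> k \<Longrightarrow> {1..k} \<subseteq> J \<Longrightarrow> A k (restrict x J) = A k x"
  using local[of k x] local[of k "restrict x J"] by (simp add: Int_absorb1)

lemma meas_superset:
  assumes "1 \<le> k" "{1..k} \<subseteq> J"
  shows "Measurable.pred (PiM J (\<lambda>_. \<mu>)) (A k)"
proof -
  have "Measurable.pred (PiM J (\<lambda>_. \<mu>)) (\<lambda>x. A k (restrict x {1..k}))"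
    by (rule measurable_compose[OF measurable_restrict_subset[OF assms(2)] meas[OF assms(1)]])
  then show ?thesis by (simp only: local[OF assms(1)])
qed

text \<open>Points of the product space over \<open>{1..}\<close> are \<open>undefined\<close>
  outside the index set, so a raw path need not be such a point. This lemma allows passing between
  the two.\<close>

lemma first_time_restrict: "first_time A (restrict x {1..}) = first_time A x"
proof -
  have "{k. 1 \<le> k \<and> A k (restrict x {1..})} = {k. 1 \<le> k \<and> A k x}"
    using restrict_eq[of _ "{1..}" x] by auto
  then show ?thesis unfolding first_time_def by simp
qed

lemma first_time_measurable [measurable]:
  "first_time A \<in> measurable (PiM {1..} (\<lambda>_. \<mu>)) (count_space UNIV)"
  by (rule measurable_first_time[where Y="\<lambda>x. x"]) (auto intro: meas_superset)

text \<open>The change-point is \<open>m + 1\<close>, where the restarted procedure sees its first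
  observation. If that one stops at \<open>k\<close>, then by \<open>shift\<close> the original one
  stops by \<open>k + m\<close>, and \<open>k + m - (m + 1) = k - 1\<close>. Truncated subtraction
  turns an alarm before the change into delay 0.\<close>

lemma first_time_shift: "first_time A x - enat (Suc m) \<le> first_time A (\<lambda>j. x (j + m)) - enat 1"
proof (cases "first_time A (\<lambda>j. x (j + m))")
  case (enat t)
  \<comment> \<open>A finite infimum is attained, so there is an alarm at some
    \<open>k \<le> t\<close>.\<close>
  then have "\<not> enat (Suc t) \<le> first_time A (\<lambda>j. x (j + m))" by simp
  then obtain k where k: "1 \<le> k" "k < Suc t" "A k (\<lambda>j. x (j + m))"
    unfolding le_first_time_iff by auto
  have "first_time A x \<le> enat (k + m)"
    by (rule first_time_le) (use k shift in auto)
  also have "\<dots> \<le> enat (t + m)" using k by simp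
  finally show ?thesis
    unfolding enat by (cases "first_time A x") auto
qed auto

end

section \<open>The law of the observations from the change on, and their independence of the
  past\<close>

definition path_law :: "'a measure \<Rightarrow> ('a \<Rightarrow> real) \<Rightarrow> ('a \<Rightarrow> real) \<Rightarrow> ('a \<Rightarrow> real) \<Rightarrow> nat \<Rightarrow> (nat \<Rightarrow> 'a) measure"
  where "path_law \<mu> f0 f1 f2 d =
    PiM {1..} (\<lambda>k. density \<mu> (\<lambda>x. ennreal (obs_density f0 f1 f2 d 1 k x)))"

context transient_change_model
begin

lemma X_measurable: "1 \<le> v \<Longrightarrow> 1 \<le> k \<Longrightarrow> X k \<in> measurable (P d v) \<mu>"
  using law by (rule distributed_measurable)

lemma restrict_X_measurable:
  assumes "1 \<le> v" "J \<subseteq> {1..}"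
  shows "(\<lambda>\<omega>. \<lambda>j\<in>J. X (j + m) \<omega>) \<in> measurable (P d v) (PiM J (\<lambda>_. \<mu>))"
  using assms by (intro measurable_restrict X_measurable) auto

text \<open>By independence the joint law is a product. Relabelling by the injection from
  \<open>j\<close> to \<open>j + (v - 1)\<close> keeps it a product, and the density at time
  \<open>k + (v - 1)\<close> for change-point \<open>v\<close> is that at time \<open>k\<close> for
  change-point 1. Hence the result is free of \<open>v\<close>.\<close>

lemma distr_shifted_path:
  assumes v: "1 \<le> v"
  shows "distr (P d v) (PiM {1..} (\<lambda>_. \<mu>)) (\<lambda>\<omega>. \<lambda>j\<in>{1..}. X (j + (v - 1)) \<omega>) = path_law \<mu> f0 f1 f2 d"
proof -
  let ?m = "v - 1"
  let ?\<nu> = "\<lambda>k. density \<mu> (\<lambda>x. ennreal (obs_density f0 f1 f2 d v k x))"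
  let ?r = "\<lambda>\<omega>. \<lambda>j\<in>{1..}. X j \<omega>"
  interpret prob_space "P d v" using prob[OF v] .
  have \<nu>: "?\<nu> k = distr (P d v) \<mu> (X k)" if "1 \<le> k" for k
    using distributed_distr_eq_density[OF law[OF v that]] by simp
  have \<nu>_prob: "prob_space (?\<nu> k)" if "1 \<le> k" for k
    unfolding \<nu>[OF that] using X_measurable[OF v that] by (rule prob_space_distr)
  have r: "?r \<in> measurable (P d v) (PiM {1..} (\<lambda>_. \<mu>))"
    using restrict_X_measurable[OF v, of "{1..}" 0] by simp
  have joint: "distr (P d v) (PiM {1..} (\<lambda>_. \<mu>)) ?r = PiM {1..} ?\<nu>"
    using indep_vars_iff_distr_eq_PiM'[where I="{1..}" and M'="\<lambda>_. \<mu>" and X=X] indep[OF v, of d] X_measurable[OF v]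
      PiM_cong[OF refl \<nu>, of "{1..}" "\<lambda>k. k"]
    by simp
  have sets_eq: "sets (PiM J (\<lambda>j. ?\<nu> (g j))) = sets (PiM J (\<lambda>_. \<mu>))" for J and g :: "nat \<Rightarrow> nat"
    by (intro sets_PiM_cong) auto
  have shift: "(\<lambda>x. \<lambda>j\<in>{1..}. x (j + ?m)) \<in> measurable (PiM {1..} (\<lambda>_. \<mu>)) (PiM {1..} (\<lambda>_. \<mu>))"
    by (intro measurable_restrict measurable_component_singleton) auto
  have "distr (P d v) (PiM {1..} (\<lambda>_. \<mu>)) (\<lambda>\<omega>. \<lambda>j\<in>{1..}. X (j + ?m) \<omega>) =
    distr (distr (P d v) (PiM {1..} (\<lambda>_. \<mu>)) ?r) (PiM {1..} (\<lambda>_. \<mu>)) (\<lambda>x. \<lambda>j\<in>{1..}. x (j + ?m))"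
    by (subst distr_distr[OF shift r]) (auto intro!: distr_cong simp: fun_eq_iff)
  \<comment> \<open>Only the measurable sets of the target matter to \<open>distr\<close>, so it may
    be replaced by the product law that the reindexing lemma expects.\<close>
  also have "\<dots> = distr (PiM {1..} ?\<nu>) (PiM {1..} (\<lambda>j. ?\<nu> (j + ?m))) (\<lambda>x. \<lambda>j\<in>{1..}. x (j + ?m))"
    unfolding joint using sets_eq[of _ "\<lambda>j. j + ?m"] by (intro distr_cong) auto
  also have "\<dots> = PiM {1..} (\<lambda>j. ?\<nu> (j + ?m))"
    by (rule distr_PiM_reindex) (auto intro: \<nu>_prob)
  also have "\<dots> = path_law \<mu> f0 f1 f2 d"
    unfolding path_law_def using v by (intro PiM_cong) (auto simp: obs_density_def)
  finally show ?thesis .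
qed

text \<open>The observations before \<open>v\<close> are independent of those from \<open>v\<close>
  on, so Tonelli's theorem factorises the integral. Pollak's delay uses it with the event of no
  alarm before \<open>v\<close>; Lorden's uses all past events \<open>B\<close>, which characterise
  the conditional expectation.\<close>

lemma nn_integral_future:
  assumes v: "1 \<le> v" and [measurable]: "g \<in> borel_measurable (PiM {1..} (\<lambda>_. \<mu>))"
    and B: "B \<in> sets (obs_algebra (space (P d v)) \<mu> X (v - 1))"
  shows "(\<integral>\<^sup>+\<omega>. g (\<lambda>j\<in>{1..}. X (j + (v - 1)) \<omega>) * indicator B \<omega> \<partial>P d v) =
    (\<integral>\<^sup>+x. g x \<partial>path_law \<mu> f0 f1 f2 d) * emeasure (P d v) B"
proof -
  let ?past = "\<lambda>\<omega>. \<lambda>j\<in>{1..v - 1}. X j \<omega>" and ?fut = "\<lambda>\<omega>. \<lambda>j\<in>{v..}. X j \<omega>"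
  let ?M1 = "PiM {1..v - 1} (\<lambda>_. \<mu>)" and ?M2 = "PiM {v..} (\<lambda>_. \<mu>)"
  let ?re = "\<lambda>x. \<lambda>j\<in>{1..}. x (j + (v - 1))"
  interpret prob_space "P d v" using prob[OF v] .
  have [measurable]: "?past \<in> measurable (P d v) ?M1" "?fut \<in> measurable (P d v) ?M2"
    using restrict_X_measurable[OF v, of "{1..v - 1}" 0] restrict_X_measurable[OF v, of "{v..}" 0] v
    by auto
  have [measurable]: "?re \<in> measurable ?M2 (PiM {1..} (\<lambda>_. \<mu>))"
    by (intro measurable_restrict measurable_component_singleton) auto
  from B obtain C where C [measurable]: "C \<in> sets ?M1" and B_eq: "B = ?past -` C \<inter> space (P d v)"
    unfolding obs_algebra_def using measurable_space[of ?past "P d v" ?M1]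
    by (subst (asm) sets_vimage_algebra2) auto
  have re_fut: "?re (?fut \<omega>) = (\<lambda>j\<in>{1..}. X (j + (v - 1)) \<omega>)" for \<omega>
    using v by (auto simp: fun_eq_iff)
  have ind: "indep_var ?M1 ?past ?M2 ?fut"
    by (rule indep_var_restrict[OF indep[OF v]]) (use v in auto)
  interpret M2: prob_space "distr (P d v) ?M2 ?fut" by (rule prob_space_distr) simp
  have "(\<integral>\<^sup>+\<omega>. g (\<lambda>j\<in>{1..}. X (j + (v - 1)) \<omega>) * indicator B \<omega> \<partial>P d v) =
    (\<integral>\<^sup>+\<omega>. g (?re (?fut \<omega>)) * indicator C (?past \<omega>) \<partial>P d v)"
    unfolding re_fut B_eq by (intro nn_integral_cong) (auto simp: indicator_def)
  also have "\<dots> = (\<integral>\<^sup>+z. g (?re (snd z)) * indicator C (fst z)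
      \<partial>distr (P d v) (?M1 \<Otimes>\<^sub>M ?M2) (\<lambda>\<omega>. (?past \<omega>, ?fut \<omega>)))"
    by (subst nn_integral_distr) auto
  also have "\<dots> = (\<integral>\<^sup>+z. g (?re (snd z)) * indicator C (fst z)
      \<partial>(distr (P d v) ?M1 ?past \<Otimes>\<^sub>M distr (P d v) ?M2 ?fut))"
    using ind unfolding indep_var_distribution_eq by simp
  also have "\<dots> = (\<integral>\<^sup>+y. (\<integral>\<^sup>+x. g (?re x) * indicator C y \<partial>distr (P d v) ?M2 ?fut)
      \<partial>distr (P d v) ?M1 ?past)"
    by (subst M2.nn_integral_fst[symmetric]) auto
  also have "\<dots> = (\<integral>\<^sup>+y. (\<integral>\<^sup>+x. g (?re x) \<partial>distr (P d v) ?M2 ?fut) * indicator C y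
      \<partial>distr (P d v) ?M1 ?past)"
    by (intro nn_integral_cong nn_integral_multc) auto
  also have "\<dots> = (\<integral>\<^sup>+x. g (?re x) \<partial>distr (P d v) ?M2 ?fut) * emeasure (P d v) B"
    by (subst nn_integral_cmult) (auto simp: emeasure_distr B_eq)
  also have "(\<integral>\<^sup>+x. g (?re x) \<partial>distr (P d v) ?M2 ?fut) =
      (\<integral>\<^sup>+\<omega>. g (\<lambda>j\<in>{1..}. X (j + (v - 1)) \<omega>) \<partial>P d v)"
    by (subst nn_integral_distr) (simp_all add: re_fut[simplified] re_fut del: restrict_apply)
  also have "\<dots> = (\<integral>\<^sup>+x. g x \<partial>path_law \<mu> f0 f1 f2 d)"
    unfolding distr_shifted_path[OF v, symmetric]
    by (subst nn_integral_distr) (auto intro!: restrict_X_measurable v)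
  finally show ?thesis .
qed

lemma obs_algebra_subalgebra:
  assumes "1 \<le> v" shows "subalgebra (P d v) (obs_algebra (space (P d v)) \<mu> X n)"
proof -
  have "(\<lambda>\<omega>. \<lambda>j\<in>{1..n}. X j \<omega>) \<in> measurable (P d v) (PiM {1..n} (\<lambda>_. \<mu>))"
    using restrict_X_measurable[OF assms, of "{1..n}" 0] by auto
  then show ?thesis
    unfolding subalgebra_def obs_algebra_def using sets_image_in_sets by force
qed

end

section \<open>Equality of the two worst-case delays\<close>

locale alarm_model =
  transient_change_model \<Omega> \<mu> f0 f1 f2 P X + alarm_rule \<mu> A
  for \<Omega> :: "'w measure"
    and \<mu> :: "'a measure"
    and f0 f1 f2 :: "'a \<Rightarrow> real"
    and P :: "nat \<Rightarrow> nat \<Rightarrow> 'w measure"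
    and X :: "nat \<Rightarrow> 'w \<Rightarrow> 'a"
    and A :: "nat \<Rightarrow> (nat \<Rightarrow> 'a) \<Rightarrow> bool"
begin

definition \<tau> :: "'w \<Rightarrow> enat" where "\<tau> \<omega> = first_time A (\<lambda>j. X j \<omega>)"

text \<open>Formed on path space, hence free of \<open>v\<close> from the start; both worst-case
  delays turn out to equal it.\<close>

definition worst_delay :: "nat \<Rightarrow> ennreal" where
  "worst_delay d = (\<integral>\<^sup>+x. ennreal_of_enat (first_time A x - enat 1) \<partial>path_law \<mu> f0 f1 f2 d)"

lemma ennreal_of_enat_measurable:
  "T \<in> measurable M (count_space UNIV) \<Longrightarrow> (\<lambda>\<omega>. ennreal_of_enat (T \<omega> - e)) \<in> borel_measurable M"
  by (rule measurable_compose) auto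

lemma \<tau>_measurable:
  assumes "1 \<le> v" shows "\<tau> \<in> measurable (P d v) (count_space UNIV)"
proof -
  have "(\<lambda>\<omega>. first_time A (\<lambda>j\<in>{1..}. X (j + 0) \<omega>)) \<in> measurable (P d v) (count_space UNIV)"
    by (rule measurable_compose[OF restrict_X_measurable[OF assms] first_time_measurable]) simp
  then show ?thesis by (simp only: \<tau>_def[abs_def] first_time_restrict add_0_right)
qed

lemma \<tau>_le_future:
  assumes "1 \<le> v"
  shows "ennreal_of_enat (\<tau> \<omega> - enat v) \<le>
    ennreal_of_enat (first_time A (\<lambda>j\<in>{1..}. X (j + (v - 1)) \<omega>) - enat 1)"
  using first_time_shift[of "\<lambda>j. X j \<omega>" "v - 1"] assms
  by (simp add: first_time_restrict \<tau>_def ennreal_of_enat_le_iff)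

text \<open>The event excludes alarms at the times \<open>1\<close> to \<open>v - 1\<close>, so the
  observations before the change determine it.\<close>

lemma ge_in_past:
  assumes "1 \<le> v"
  shows "{\<omega> \<in> space (P d v). enat v \<le> \<tau> \<omega>} \<in> sets (obs_algebra (space (P d v)) \<mu> X (v - 1))"
proof -
  let ?past = "\<lambda>\<omega>. \<lambda>j\<in>{1..v - 1}. X j \<omega>" and ?M1 = "PiM {1..v - 1} (\<lambda>_. \<mu>)"
  have past: "?past \<in> measurable (P d v) ?M1"
    using restrict_X_measurable[OF assms, of "{1..v - 1}" 0] by auto
  have "Measurable.pred ?M1 (\<lambda>x. \<forall>k\<in>{1..<v}. \<not> A k x)"
    by (intro pred_intros_finite pred_intros_logic meas_superset) auto
  then have C: "{x \<in> space ?M1. \<forall>k\<in>{1..<v}. \<not> A k x} \<in> sets ?M1" by (simp add: pred_def)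
  have "A k (?past \<omega>) = A k (\<lambda>j. X j \<omega>)" if "k \<in> {1..<v}" for k \<omega>
    by (rule restrict_eq) (use that in auto)
  then have "{\<omega> \<in> space (P d v). enat v \<le> \<tau> \<omega>} =
    ?past -` {x \<in> space ?M1. \<forall>k\<in>{1..<v}. \<not> A k x} \<inter> space (P d v)"
    using measurable_space[OF past] by (auto simp: \<tau>_def le_first_time_iff)
  then show ?thesis unfolding obs_algebra_def using in_vimage_algebra[OF C] by simp
qed

lemma first_time_ge_1: "enat 1 \<le> first_time A x"
  by (simp add: le_first_time_iff)

lemma worst_delay_eq: "worst_delay d = (\<integral>\<^sup>+\<omega>. ennreal_of_enat (\<tau> \<omega> - enat 1) \<partial>P d 1)"
proof -
  have "(\<integral>\<^sup>+x. ennreal_of_enat (first_time A x - enat 1)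
      \<partial>distr (P d 1) (PiM {1..} (\<lambda>_. \<mu>)) (\<lambda>\<omega>. \<lambda>j\<in>{1..}. X (j + (1 - 1)) \<omega>)) =
    (\<integral>\<^sup>+\<omega>. ennreal_of_enat (\<tau> \<omega> - enat 1) \<partial>P d 1)"
    using restrict_X_measurable[of 1 "{1..}" 0 d]
    by (subst nn_integral_distr)
       (auto simp: \<tau>_def first_time_restrict
          intro!: ennreal_of_enat_measurable first_time_measurable)
  then show ?thesis unfolding worst_delay_def distr_shifted_path[OF order_refl] .
qed

text \<open>Upper bound: the delay is dominated pathwise by a functional of the future, which is
  independent of the conditioning event. Lower bound: for \<open>v = 1\<close> the conditioning
  event is the whole space.\<close>

lemma pollak_delay_eq: "pollak_delay (P d) \<tau> = worst_delay d"
proof (rule antisym)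
  show "pollak_delay (P d) \<tau> \<le> worst_delay d"
    unfolding pollak_delay_def
  proof (rule SUP_least)
    fix v :: nat assume "v \<in> {1..}" then have v: "1 \<le> v" by simp
    interpret prob_space "P d v" using prob[OF v] .
    let ?B = "{\<omega> \<in> space (P d v). enat v \<le> \<tau> \<omega>}"
    have B: "?B \<in> sets (obs_algebra (space (P d v)) \<mu> X (v - 1))" by (rule ge_in_past[OF v])
    then have B': "?B \<in> sets (P d v)"
      using obs_algebra_subalgebra[OF v] unfolding subalgebra_def by blast
    have "(\<integral>\<^sup>+\<omega>. ennreal_of_enat (\<tau> \<omega> - enat v) \<partial>uniform_measure (P d v) ?B) =
      (\<integral>\<^sup>+\<omega>. ennreal_of_enat (\<tau> \<omega> - enat v) * indicator ?B \<omega> \<partial>P d v) / emeasure (P d v) ?B"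
      by (rule nn_integral_uniform_measure[OF ennreal_of_enat_measurable[OF \<tau>_measurable[OF v]] B'])
    also have "\<dots> \<le> (\<integral>\<^sup>+\<omega>. ennreal_of_enat (first_time A (\<lambda>j\<in>{1..}. X (j + (v - 1)) \<omega>) - enat 1)
        * indicator ?B \<omega> \<partial>P d v) / emeasure (P d v) ?B"
      by (intro divide_right_mono_ennreal nn_integral_mono mult_right_mono \<tau>_le_future v) auto
    also have "\<dots> = worst_delay d * emeasure (P d v) ?B / emeasure (P d v) ?B"
      unfolding worst_delay_def
      by (subst nn_integral_future[OF v _ B])
         (auto intro: ennreal_of_enat_measurable first_time_measurable)
    \<comment> \<open>A null conditioning event gives 0, because \<open>0 / 0 = 0\<close> on
      \<open>ennreal\<close>; otherwise its finite nonzero probability cancels.\<close>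
    also have "\<dots> \<le> worst_delay d"
      by (cases "emeasure (P d v) ?B = 0") (auto simp: ennreal_mult_divide_eq)
    finally show "(\<integral>\<^sup>+\<omega>. ennreal_of_enat (\<tau> \<omega> - enat v) \<partial>uniform_measure (P d v) ?B) \<le> worst_delay d" .
  qed
  interpret prob_space "P d 1" by (rule prob) simp
  have B: "{\<omega> \<in> space (P d 1). enat 1 \<le> \<tau> \<omega>} = space (P d 1)"
    using first_time_ge_1 by (auto simp: \<tau>_def)
  have "worst_delay d = (\<integral>\<^sup>+\<omega>. ennreal_of_enat (\<tau> \<omega> - enat 1) * indicator (space (P d 1)) \<omega> \<partial>P d 1)"
    unfolding worst_delay_eq by (intro nn_integral_cong) auto
  also have "\<dots> = (\<integral>\<^sup>+\<omega>. ennreal_of_enat (\<tau> \<omega> - enat 1) * indicator (space (P d 1)) \<omega> \<partial>P d 1)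
      / emeasure (P d 1) (space (P d 1))"
    by (simp add: emeasure_space_1 divide_ennreal_def)
  also have "\<dots> = (\<integral>\<^sup>+\<omega>. ennreal_of_enat (\<tau> \<omega> - enat 1)
      \<partial>uniform_measure (P d 1) {\<omega> \<in> space (P d 1). enat 1 \<le> \<tau> \<omega>})"
    unfolding B
    by (rule nn_integral_uniform_measure[symmetric])
       (auto intro!: ennreal_of_enat_measurable \<tau>_measurable)
  also have "\<dots> \<le> pollak_delay (P d) \<tau>"
    unfolding pollak_delay_def by (rule SUP_upper) simp
  finally show "worst_delay d \<le> pollak_delay (P d) \<tau>" .
qed

text \<open>The dominating functional of the future has an almost surely constant conditional
  expectation given the past. Monotonicity gives one inequality for every \<open>v\<close>, and
  \<open>v = 1\<close> gives the other.\<close>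

lemma lorden_delay_eq: "lorden_delay \<mu> X (P d) \<tau> = worst_delay d"
proof -
  let ?F = "\<lambda>v. obs_algebra (space (P d v)) \<mu> X (v - 1)"
  let ?g = "\<lambda>v \<omega>. ennreal_of_enat (first_time A (\<lambda>j\<in>{1..}. X (j + (v - 1)) \<omega>) - enat 1)"
  have fut: "AE \<omega> in P d v. worst_delay d = nn_cond_exp (P d v) (?F v) (?g v) \<omega>"
    and g: "?g v \<in> borel_measurable (P d v)"
    and sub: "sigma_finite_subalgebra (P d v) (?F v)" if v: "1 \<le> v" for v
  proof -
    interpret prob_space "P d v" using prob[OF v] .
    interpret finite_measure_subalgebra "P d v" "?F v"
      by standard (rule obs_algebra_subalgebra[OF v])
    show "sigma_finite_subalgebra (P d v) (?F v)" ..
    show g: "?g v \<in> borel_measurable (P d v)"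
      by (rule measurable_compose[OF restrict_X_measurable[OF v]
            ennreal_of_enat_measurable[OF first_time_measurable]]) simp
    show "AE \<omega> in P d v. worst_delay d = nn_cond_exp (P d v) (?F v) (?g v) \<omega>"
    proof (rule nn_cond_exp_charact[OF _ g])
      fix B assume B: "B \<in> sets (?F v)"
      then have B': "B \<in> sets (P d v)"
        using subalg unfolding subalgebra_def by blast
      show "(\<integral>\<^sup>+\<omega>\<in>B. ?g v \<omega> \<partial>P d v) = (\<integral>\<^sup>+\<omega>\<in>B. worst_delay d \<partial>P d v)"
        unfolding worst_delay_def
        by (subst nn_integral_future[OF v _ B])
           (auto intro: ennreal_of_enat_measurable first_time_measurable
              simp: nn_integral_cmult_indicator B')
    qed simp
  qed
  show ?thesis
  proof (rule antisym)
    show "lorden_delay \<mu> X (P d) \<tau> \<le> worst_delay d"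
      unfolding lorden_delay_def
    proof (rule SUP_least)
      fix v :: nat assume "v \<in> {1..}" then have v: "1 \<le> v" by simp
      interpret sigma_finite_subalgebra "P d v" "?F v" by (rule sub[OF v])
      have "AE \<omega> in P d v. nn_cond_exp (P d v) (?F v) (\<lambda>\<omega>. ennreal_of_enat (\<tau> \<omega> - enat v)) \<omega> \<le>
          nn_cond_exp (P d v) (?F v) (?g v) \<omega>"
        by (intro nn_cond_exp_mono AE_I2 \<tau>_le_future v g ennreal_of_enat_measurable \<tau>_measurable)
      with fut[OF v] have "AE \<omega> in P d v.
          nn_cond_exp (P d v) (?F v) (\<lambda>\<omega>. ennreal_of_enat (\<tau> \<omega> - enat v)) \<omega> \<le> worst_delay d"
        by eventually_elim simp
      then show "esssup (P d v) (nn_cond_exp (P d v) (?F v) (\<lambda>\<omega>. ennreal_of_enat (\<tau> \<omega> - enat v)))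
          \<le> worst_delay d"
        by (intro esssup_I borel_measurable_nn_cond_exp2)
    qed
    interpret prob_space "P d 1" by (rule prob) simp
    interpret sigma_finite_subalgebra "P d 1" "?F 1" by (rule sub) simp
    \<comment> \<open>For \<open>v = 1\<close> there is no shift, and the domination is an
      equality.\<close>
    have "?g 1 = (\<lambda>\<omega>. ennreal_of_enat (\<tau> \<omega> - enat 1))"
      by (simp add: first_time_restrict \<tau>_def fun_eq_iff)
    then have eq: "AE \<omega> in P d 1. worst_delay d =
        nn_cond_exp (P d 1) (?F 1) (\<lambda>\<omega>. ennreal_of_enat (\<tau> \<omega> - enat 1)) \<omega>"
      using fut[of 1] by simp
    have "worst_delay d = esssup (P d 1) (\<lambda>_. worst_delay d)"
      by (rule esssup_const[symmetric]) (simp add: emeasure_space_1)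
    also have "\<dots> = esssup (P d 1)
        (nn_cond_exp (P d 1) (?F 1) (\<lambda>\<omega>. ennreal_of_enat (\<tau> \<omega> - enat 1)))"
      by (rule esssup_AE_cong[OF _ _ eq]) auto
    also have "\<dots> \<le> lorden_delay \<mu> X (P d) \<tau>"
      unfolding lorden_delay_def by (rule SUP_upper) simp
    finally show "worst_delay d \<le> lorden_delay \<mu> X (P d) \<tau>" .
  qed
qed

end

subsection \<open>Exponential moments and Chernoff's bound\<close>

text \<open>Convexity of the exponential function gives the first bound, its tangent at 0 the
  second. Together they supply a majorant independent of \<open>s\<close> for dominated
  convergence.\<close>

lemma one_minus_exp_bounds:
  fixes s z :: real
  assumes "0 < s" "s \<le> 1"
  shows "1 - exp (- z) \<le> (1 - exp (- (s * z))) / s" and "(1 - exp (- (s * z))) / s \<le> z"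
proof -
  have "exp ((1 - s) *\<^sub>R 0 + s *\<^sub>R (- z)) \<le> (1 - s) * exp 0 + s * exp (- z)"
    using convex_onD[OF exp_convex, of s 0 "- z"] assms by simp
  then show "1 - exp (- z) \<le> (1 - exp (- (s * z))) / s"
    using assms by (simp add: field_simps)
  show "(1 - exp (- (s * z))) / s \<le> z"
    using exp_ge_add_one_self[of "- (s * z)"] assms by (simp add: field_simps)
qed

text \<open>These are difference quotients at 0 of the function \<open>- exp (- (s * z))\<close> of
  \<open>s\<close>. The parameters \<open>1 / (n + 1)\<close> form a sequence, as dominated
  convergence requires, and lie in the range of the preceding bounds.\<close>

lemma one_minus_exp_tendsto:
  "(\<lambda>n. (1 - exp (- (inverse (real (Suc n)) * z))) / inverse (real (Suc n))) \<longlonglongrightarrow> z"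
proof -
  have "((\<lambda>s. - exp (- (s * z))) has_real_derivative z) (at 0)"
    by (auto intro!: derivative_eq_intros)
  then have "((\<lambda>h. (1 - exp (- (h * z))) / h) \<longlongrightarrow> z) (at 0)"
    by (simp add: DERIV_def)
  moreover have "filterlim (\<lambda>n. inverse (real (Suc n))) (at 0) sequentially"
    unfolding filterlim_at using LIMSEQ_inverse_real_of_nat by auto
  ultimately show ?thesis by (rule filterlim_compose)
qed

lemma suminf_le_geometric_tail:
  fixes g :: "nat \<Rightarrow> ennreal"
  assumes "\<And>t. t < N \<Longrightarrow> g t \<le> 1" "\<And>t. N \<le> t \<Longrightarrow> g t \<le> ennreal (q ^ (t - N))" "0 \<le> q" "q < 1"
  shows "(\<Sum>t. g t) \<le> ennreal (real N + 1 / (1 - q))"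
proof -
  let ?h = "\<lambda>t. if t < N then 1 else q ^ (t - N)"
  have "(\<lambda>i. ?h (i + N)) sums (1 / (1 - q))"
    using geometric_sums[of q] assms by simp
  then have "?h sums (real N + 1 / (1 - q))"
    using sums_iff_shift[of ?h N "1 / (1 - q)"] by (simp add: add.commute)
  then have "(\<Sum>t. ennreal (?h t)) = ennreal (real N + 1 / (1 - q))"
    using assms by (intro suminf_ennreal_eq) auto
  moreover have "(\<Sum>t. g t) \<le> (\<Sum>t. ennreal (?h t))"
    using assms by (intro suminf_le) auto
  ultimately show ?thesis by simp
qed

lemma sum_if_le:
  fixes a b :: real
  shows "(\<Sum>j\<in>{1..n}. if j \<le> d then a else b) = real (min n d) * a + real (n - d) * b"
proof (induction n)
  case (Suc n)
  show ?case
    using Suc by (cases "Suc n \<le> d") (auto simp: min_def algebra_simps Suc_diff_le)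
qed simp

context transient_change_model
begin

text \<open>The integrand below is at most \<open>f + f0\<close>, whence the likelihood ratio has negative moments of all orders
  in \<open>[0, 1]\<close> without further assumptions, and the derivative at \<open>0\<close> is minus the divergence.\<close>

lemma exp_moment:
  assumes f: "f \<in> {f1, f2}" and \<eta>: "0 < \<eta>"
  shows "\<forall>\<^sub>F n in sequentially.
    (\<integral>\<^sup>+x. ennreal (f x * exp (- (inverse (real (Suc n)) * ln (f x / f0 x)))) \<partial>\<mu>)
      \<le> ennreal (exp (- (inverse (real (Suc n)) * (info_number \<mu> f f0 - \<eta>))))"
proof -
  let ?s = "\<lambda>n. inverse (real (Suc n))" and ?z = "\<lambda>x. ln (f x / f0 x)"
  let ?G = "\<lambda>n x. f x * ((1 - exp (- (?s n * ?z x))) / ?s n)"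
  let ?w = "\<lambda>x. \<bar>f x * ?z x\<bar> + f x + f0 x"
  have s: "0 < ?s n" "?s n \<le> 1" for n
    using inverse_le_1_iff[of "real (Suc n)"] by auto
  have [measurable]: "f \<in> borel_measurable \<mu>" "f0 \<in> borel_measurable \<mu>"
    using f measurable_densities by auto
  have nonneg: "0 \<le> f x" "0 \<le> f0 x" if "x \<in> space \<mu>" for x
    using f nonneg_densities that by auto
  have int: "integrable \<mu> f" "integrable \<mu> f0" and one: "(\<integral>x. f x \<partial>\<mu>) = 1"
    using normalized_densities[OF insertI2[OF f]] normalized_densities[of f0] nonneg
    by (auto intro!: integrableI_nonneg simp: integral_eq_nn_integral)
  have int_info: "integrable \<mu> (\<lambda>x. f x * ?z x)"
    using integrable_info[OF f] .
  have bound: "AE x in \<mu>. norm (?G n x) \<le> ?w x" for n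
    using abs_cont[OF f] AE_space
  proof eventually_elim
    case (elim x)
    show ?case
    proof (cases "f x = 0")
      case False
      then have pos: "0 < f x" "0 < f0 x" using elim nonneg[of x] by (auto simp: less_le)
      have "\<bar>(1 - exp (- (?s n * ?z x))) / ?s n\<bar> \<le> \<bar>?z x\<bar> + 1 + exp (- ?z x)"
        using one_minus_exp_bounds[OF s(1)[of n] s(2)[of n], of "?z x"] exp_gt_zero[of "- ?z x"] by linarith
      then have "norm (?G n x) \<le> f x * (\<bar>?z x\<bar> + 1 + exp (- ?z x))"
        unfolding real_norm_def abs_mult abs_of_pos[OF pos(1)]
        by (rule mult_left_mono) (use pos in simp)
      \<comment> \<open>Multiplication by \<open>f x\<close> turns this term into
        \<open>f0 x\<close>, which is integrable.\<close>
      also have "exp (- ?z x) = f0 x / f x"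
        using pos by (simp add: exp_minus)
      also have "f x * (\<bar>?z x\<bar> + 1 + f0 x / f x) = ?w x"
        using pos by (simp add: abs_mult field_simps)
      finally show ?thesis .
    qed (use nonneg elim in auto)
  qed
  have lim: "AE x in \<mu>. (\<lambda>n. ?G n x) \<longlonglongrightarrow> f x * ?z x"
    by (intro AE_I2 tendsto_mult tendsto_const one_minus_exp_tendsto)
  have G: "integrable \<mu> (?G n)" for n
    by (rule integrable_dominated_convergence2[OF _ _ _ lim bound]) (use int int_info in auto)
  have "(\<lambda>n. \<integral>x. ?G n x \<partial>\<mu>) \<longlonglongrightarrow> info_number \<mu> f f0"
    unfolding info_number_def
    by (rule integral_dominated_convergence[OF _ _ _ lim bound]) (use int int_info in auto)
  then have "\<forall>\<^sub>F n in sequentially. info_number \<mu> f f0 - \<eta> < (\<integral>x. ?G n x \<partial>\<mu>)"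
    using \<eta> by (intro order_tendstoD) auto
  then show ?thesis
  proof eventually_elim
    case (elim n)
    have eq: "(\<lambda>x. f x * exp (- (?s n * ?z x))) = (\<lambda>x. f x - ?s n * ?G n x)"
      by (simp add: fun_eq_iff field_simps)
    have "integrable \<mu> (\<lambda>x. f x * exp (- (?s n * ?z x)))"
      unfolding eq by (intro Bochner_Integration.integrable_diff integrable_mult_right int G)
    then have "(\<integral>\<^sup>+x. ennreal (f x * exp (- (?s n * ?z x))) \<partial>\<mu>) = ennreal (\<integral>x. f x * exp (- (?s n * ?z x)) \<partial>\<mu>)"
      by (intro nn_integral_eq_integral AE_I2 mult_nonneg_nonneg nonneg) auto
    also have "(\<integral>x. f x * exp (- (?s n * ?z x)) \<partial>\<mu>) = 1 - ?s n * (\<integral>x. ?G n x \<partial>\<mu>)"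
      unfolding eq by (simp only: Bochner_Integration.integral_diff integrable_mult_right integral_mult_right_zero int G one)
    \<comment> \<open>The first-order bound is put into exponential form, so that the factors of
      independent observations multiply.\<close>
    also have "\<dots> \<le> 1 - ?s n * (info_number \<mu> f f0 - \<eta>)"
      using mult_left_mono[OF less_imp_le[OF elim] less_imp_le[OF s(1)[of n]]] by linarith
    also have "\<dots> \<le> exp (- (?s n * (info_number \<mu> f f0 - \<eta>)))"
      using exp_ge_add_one_self[of "- (?s n * (info_number \<mu> f f0 - \<eta>))"] by simp
    finally show ?case by (simp add: ennreal_leI)
  qed
qed

text \<open>The likelihood ratio of observation \<open>j\<close> for change-point 1, whose transient
  phase consists of the times \<open>1\<close> to \<open>d\<close>.\<close>

definition lr :: "nat \<Rightarrow> nat \<Rightarrow> 'a \<Rightarrow> real" where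
  "lr d j x = (if j \<le> d then f1 x else f2 x) / f0 x"

text \<open>An observation almost surely falls where its density is positive, and there
  \<open>f0\<close> is positive by \<open>abs_cont\<close>. Outside a null set \<open>ln\<close> is
  therefore a genuine logarithm, untouched by the convention \<open>ln 0 = 0\<close>.\<close>

lemma lr_pos:
  assumes "1 \<le> j" shows "AE \<omega> in P d 1. 0 < lr d j (X j \<omega>)"
proof -
  interpret prob_space "P d 1" by (rule prob) simp
  have [measurable]: "f0 \<in> borel_measurable \<mu>" "f1 \<in> borel_measurable \<mu>" "f2 \<in> borel_measurable \<mu>"
    using measurable_densities by auto
  have [measurable]: "lr d j \<in> borel_measurable \<mu>"
    unfolding lr_def[abs_def] by simp
  have "AE x in \<mu>. 0 < ennreal (obs_density f0 f1 f2 d 1 j x) \<longrightarrow> 0 < lr d j x"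
    using abs_cont[of f1, simplified] abs_cont[of f2, simplified] AE_space
  proof eventually_elim
    case (elim x)
    then have "0 < f0 x" if "0 < f1 x \<or> 0 < f2 x"
      using that nonneg_densities[of f0 x] by (auto simp: less_le)
    then show ?case
      using assms by (auto simp: obs_density_def lr_def intro!: divide_pos_pos)
  qed
  then show ?thesis
    using distributed_AE2[OF law[of 1 j d], of "\<lambda>x. 0 < lr d j x"] assms by simp
qed

text \<open>Markov's inequality for the exponential of \<open>s\<close> times \<open>y\<close> minus
  the log-likelihood sum. By independence its mean factorises into \<open>min n d\<close> transient
  factors, bounded by \<open>m1\<close>, and \<open>n - d\<close> later ones, bounded by
  \<open>m2\<close>.\<close>

lemma chernoff:
  assumes s: "0 < s"
    and m1: "(\<integral>\<^sup>+x. ennreal (f1 x * exp (- (s * ln (f1 x / f0 x)))) \<partial>\<mu>) \<le> ennreal (exp (- (s * a1)))"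
    and m2: "(\<integral>\<^sup>+x. ennreal (f2 x * exp (- (s * ln (f2 x / f0 x)))) \<partial>\<mu>) \<le> ennreal (exp (- (s * a2)))"
  shows "emeasure (P d 1) {\<omega> \<in> space (P d 1). (\<Sum>j\<in>{1..n}. ln (lr d j (X j \<omega>))) \<le> y}
    \<le> ennreal (exp (s * (y - real (min n d) * a1 - real (n - d) * a2)))"
proof -
  interpret prob_space "P d 1" by (rule prob) simp
  have [measurable]: "f0 \<in> borel_measurable \<mu>" "f1 \<in> borel_measurable \<mu>" "f2 \<in> borel_measurable \<mu>"
    using measurable_densities by auto
  let ?u = "\<lambda>j x. ennreal (exp (- (s * ln (lr d j x))))"
  let ?c = "ennreal (exp (s * y))"
  have u [measurable]: "?u j \<in> borel_measurable \<mu>" for j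
    unfolding lr_def[abs_def] by simp
  have X: "X j \<in> measurable (P d 1) \<mu>" if "j \<in> {1..n}" for j
    using that by (intro X_measurable) auto
  have uX: "(\<lambda>\<omega>. \<Prod>j\<in>{1..n}. ?u j (X j \<omega>)) \<in> borel_measurable (P d 1)"
    by (intro borel_measurable_prod_ennreal measurable_compose[OF X u])
  have mean: "(\<integral>\<^sup>+\<omega>. ?u j (X j \<omega>) \<partial>P d 1) \<le> ennreal (exp (- (s * (if j \<le> d then a1 else a2))))"
    if "1 \<le> j" for j
  proof -
    have "(\<integral>\<^sup>+\<omega>. ?u j (X j \<omega>) \<partial>P d 1) =
        (\<integral>\<^sup>+x. ennreal (obs_density f0 f1 f2 d 1 j x) * ?u j x \<partial>\<mu>)"
      using that by (intro distributed_nn_integral[symmetric] law u) auto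
    also have "\<dots> = (\<integral>\<^sup>+x. ennreal (obs_density f0 f1 f2 d 1 j x * exp (- (s * ln (lr d j x)))) \<partial>\<mu>)"
      using nonneg_densities
      by (intro nn_integral_cong ennreal_mult[symmetric]) (auto simp: obs_density_def)
    also have "\<dots> \<le> ennreal (exp (- (s * (if j \<le> d then a1 else a2))))"
      using that m1 m2 by (auto simp: obs_density_def lr_def)
    finally show ?thesis .
  qed
  have "emeasure (P d 1) {\<omega> \<in> space (P d 1). (\<Sum>j\<in>{1..n}. ln (lr d j (X j \<omega>))) \<le> y} \<le>
    emeasure (P d 1) ({\<omega> \<in> space (P d 1). 1 \<le> ?c * (\<Prod>j\<in>{1..n}. ?u j (X j \<omega>))})"
  proof (rule emeasure_mono)
    show "{\<omega> \<in> space (P d 1). (\<Sum>j\<in>{1..n}. ln (lr d j (X j \<omega>))) \<le> y} \<subseteq>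
      {\<omega> \<in> space (P d 1). 1 \<le> ?c * (\<Prod>j\<in>{1..n}. ?u j (X j \<omega>))}"
    proof safe
      fix \<omega> assume "(\<Sum>j\<in>{1..n}. ln (lr d j (X j \<omega>))) \<le> y"
      then have "0 \<le> s * y - s * (\<Sum>j\<in>{1..n}. ln (lr d j (X j \<omega>)))"
        using s by simp
      then have "1 \<le> exp (s * y + (\<Sum>j\<in>{1..n}. - (s * ln (lr d j (X j \<omega>)))))"
        by (simp add: sum_negf sum_distrib_left)
      then show "1 \<le> ?c * (\<Prod>j\<in>{1..n}. ?u j (X j \<omega>))"
        by (simp add: prod_ennreal exp_sum exp_add ennreal_mult[symmetric] prod_nonneg)
    qed
    show "{\<omega> \<in> space (P d 1). 1 \<le> ?c * (\<Prod>j\<in>{1..n}. ?u j (X j \<omega>))} \<in> events"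
      using uX by measurable
  qed
  also have "\<dots> \<le> ?c * (\<integral>\<^sup>+\<omega>. (\<Prod>j\<in>{1..n}. ?u j (X j \<omega>)) * indicator (space (P d 1)) \<omega> \<partial>P d 1)"
    by (rule nn_integral_Markov_inequality) (use uX in auto)
  also have "(\<integral>\<^sup>+\<omega>. (\<Prod>j\<in>{1..n}. ?u j (X j \<omega>)) * indicator (space (P d 1)) \<omega> \<partial>P d 1) =
      (\<integral>\<^sup>+\<omega>. (\<Prod>j\<in>{1..n}. ?u j (X j \<omega>)) \<partial>P d 1)"
    by (intro nn_integral_cong) auto
  also have "\<dots> = (\<Prod>j\<in>{1..n}. \<integral>\<^sup>+\<omega>. ?u j (X j \<omega>) \<partial>P d 1)"
  proof (rule indep_vars_nn_integral)
    have "indep_vars (\<lambda>_. \<mu>) X {1..n}"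
      by (rule indep_vars_subset[OF indep]) auto
    then show "indep_vars (\<lambda>_. borel) (\<lambda>j \<omega>. ?u j (X j \<omega>)) {1..n}"
      by (rule indep_vars_compose2) (rule u)
  qed auto
  also have "\<dots> \<le> (\<Prod>j\<in>{1..n}. ennreal (exp (- (s * (if j \<le> d then a1 else a2)))))"
    by (intro prod_mono_ennreal mean) auto
  also have "\<dots> = ennreal (exp (- s * (\<Sum>j\<in>{1..n}. if j \<le> d then a1 else a2)))"
    by (simp add: prod_ennreal exp_sum sum_distrib_left sum_negf flip: exp_sum)
  also have "?c * \<dots> = ennreal (exp (s * (y - real (min n d) * a1 - real (n - d) * a2)))"
    unfolding sum_if_le by (simp add: ennreal_mult[symmetric] exp_add[symmetric] algebra_simps)
  finally show ?thesis by (simp add: mult_left_mono)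
qed

end

section \<open>The mean delay after a change at time 1\<close>

context alarm_model
begin

text \<open>The mean is the sum of the tail probabilities: those before \<open>N\<close> are at most
  1, and from \<open>N\<close> on, where the drift has reached \<open>y\<close>, Chernoff's bound
  gives a geometric tail. The slack \<open>\<kappa>\<close> in the transient drift pays for a loss
  of \<open>\<kappa>\<close> per transient observation.\<close>

lemma worst_delay_le:
  assumes s: "0 < s" and a: "0 < a1" "0 < a2" and \<kappa>: "0 \<le> \<kappa>"
    and m1: "(\<integral>\<^sup>+x. ennreal (f1 x * exp (- (s * ln (f1 x / f0 x)))) \<partial>\<mu>)
      \<le> ennreal (exp (- (s * (a1 + \<kappa>))))"
    and m2: "(\<integral>\<^sup>+x. ennreal (f2 x * exp (- (s * ln (f2 x / f0 x)))) \<partial>\<mu>) \<le> ennreal (exp (- (s * a2)))"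
    and alarm: "\<And>n x. 1 \<le> n \<Longrightarrow> (\<forall>j\<in>{1..n}. 0 < lr d j (x j)) \<Longrightarrow>
      y + real (min n d) * \<kappa> < (\<Sum>j\<in>{1..n}. ln (lr d j (x j))) \<Longrightarrow> A n x"
    and N: "y \<le> real (min N d) * a1 + real (N - d) * a2"
  shows "worst_delay d \<le> ennreal (real N + 1 / (1 - exp (- (s * min a1 a2))))"
proof -
  interpret prob_space "P d 1" by (rule prob) simp
  let ?m = "min a1 a2"
  have m: "0 < ?m" using a by simp
  have \<tau>_1: "(\<lambda>\<omega>. \<tau> \<omega> - enat 1) \<in> measurable (P d 1) (count_space UNIV)"
    by (rule measurable_compose[OF \<tau>_measurable]) auto
  have "worst_delay d = (\<Sum>t. emeasure (P d 1) {\<omega> \<in> space (P d 1). enat t < \<tau> \<omega> - enat 1})"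
    unfolding worst_delay_eq by (rule nn_integral_enat_function[OF \<tau>_1])
  also have "\<dots> \<le> ennreal (real N + 1 / (1 - exp (- (s * ?m))))"
  proof (rule suminf_le_geometric_tail)
    fix t assume t: "N \<le> t"
    \<comment> \<open>A delay above \<open>t\<close> means stopping at \<open>t + 2\<close> or
      later, so there is no alarm at time \<open>t + 1\<close>.\<close>
    let ?n = "Suc t"
    let ?S = "{\<omega> \<in> space (P d 1). (\<Sum>j\<in>{1..?n}. ln (lr d j (X j \<omega>))) \<le> y + real (min ?n d) * \<kappa>}"
    have [measurable]: "f0 \<in> borel_measurable \<mu>" "f1 \<in> borel_measurable \<mu>" "f2 \<in> borel_measurable \<mu>"
      using measurable_densities by auto
    have lr: "lr d j \<in> borel_measurable \<mu>" for j unfolding lr_def[abs_def] by simp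
    have S: "?S \<in> events"
    proof -
      have "(\<lambda>\<omega>. \<Sum>j\<in>{1..?n}. ln (lr d j (X j \<omega>))) \<in> borel_measurable (P d 1)"
        by (intro borel_measurable_sum borel_measurable_ln measurable_compose[OF X_measurable lr]) auto
      then show ?thesis by measurable
    qed
    have "AE \<omega> in P d 1. \<forall>j\<in>{1..?n}. 0 < lr d j (X j \<omega>)"
      by (intro AE_finite_allI lr_pos) auto
    then have "AE \<omega> in P d 1. \<omega> \<in> {\<omega> \<in> space (P d 1). enat t < \<tau> \<omega> - enat 1} \<longrightarrow> \<omega> \<in> ?S"
    proof (eventually_elim, safe)
      fix \<omega> assume pos: "\<forall>j\<in>{1..?n}. 0 < lr d j (X j \<omega>)" and "enat t < \<tau> \<omega> - enat 1"
      then have "enat (Suc ?n) \<le> first_time A (\<lambda>j. X j \<omega>)"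
        unfolding \<tau>_def by (cases "first_time A (\<lambda>j. X j \<omega>)") auto
      then have "\<not> A ?n (\<lambda>j. X j \<omega>)" unfolding le_first_time_iff by auto
      then show "(\<Sum>j\<in>{1..?n}. ln (lr d j (X j \<omega>))) \<le> y + real (min ?n d) * \<kappa>"
        using alarm[of ?n "\<lambda>j. X j \<omega>"] pos by force
    qed
    then have "emeasure (P d 1) {\<omega> \<in> space (P d 1). enat t < \<tau> \<omega> - enat 1} \<le> emeasure (P d 1) ?S"
      using S by (rule emeasure_mono_AE)
    also have "\<dots> \<le> ennreal (exp (s * (y + real (min ?n d) * \<kappa>
        - real (min ?n d) * (a1 + \<kappa>) - real (?n - d) * a2)))"
      by (rule chernoff[OF s m1 m2])
    also have "\<dots> \<le> ennreal (exp (- (s * ?m)) ^ (t - N))"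
    proof -
      have inc: "real (min ?n d) - real (min N d) + (real (?n - d) - real (N - d)) = real (?n - N)"
        and mono: "real (min N d) \<le> real (min ?n d)" "real (N - d) \<le> real (?n - d)"
        using t by (auto simp: of_nat_diff min_def)
      \<comment> \<open>Each step after \<open>N\<close> adds at least \<open>?m\<close> to the
        drift; one of the \<open>?n - N\<close> steps is given up to match the exponent
        \<open>t - N\<close>.\<close>
      have "real (t - N) * ?m \<le> real (?n - N) * ?m"
        using m t by (intro mult_right_mono) auto
      also have "\<dots> = (real (min ?n d) - real (min N d)) * ?m + (real (?n - d) - real (N - d)) * ?m"
        unfolding inc[symmetric] by (simp add: algebra_simps)
      also have "\<dots> \<le> (real (min ?n d) - real (min N d)) * a1 + (real (?n - d) - real (N - d)) * a2"
        using mono by (intro add_mono mult_left_mono) auto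
      finally have "y + real (min ?n d) * \<kappa> - real (min ?n d) * (a1 + \<kappa>) - real (?n - d) * a2
          \<le> - (real (t - N) * ?m)"
        using N by (simp add: algebra_simps)
      then have "s * (y + real (min ?n d) * \<kappa> - real (min ?n d) * (a1 + \<kappa>) - real (?n - d) * a2)
          \<le> s * - (real (t - N) * ?m)"
        using s by (intro mult_left_mono) auto
      also have "\<dots> = real (t - N) * - (s * ?m)" by simp
      finally show ?thesis by (simp add: exp_of_nat_mult[symmetric] ennreal_leI)
    qed
    finally show "emeasure (P d 1) {\<omega> \<in> space (P d 1). enat t < \<tau> \<omega> - enat 1}
      \<le> ennreal (exp (- (s * ?m)) ^ (t - N))" .
  qed (use m s in \<open>auto intro: emeasure_le_1\<close>)
  finally show ?thesis .
qed

end

subsection \<open>The two procedures as likelihood ratio rules\<close>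

text \<open>\<open>I k\<close> holds the admissible pairs and \<open>w\<close> the weights.
  \<open>C\<close> is a set of values because one procedure stops at a strict and the other at a
  weak inequality. Comparing products with \<open>exp b\<close> avoids the logarithm of 0.\<close>

definition glr_rule :: "('a \<Rightarrow> real) \<Rightarrow> ('a \<Rightarrow> real) \<Rightarrow> ('a \<Rightarrow> real) \<Rightarrow> (nat \<Rightarrow> (nat \<times> nat) set) \<Rightarrow>
    (nat \<Rightarrow> nat \<Rightarrow> nat \<Rightarrow> real) \<Rightarrow> real set \<Rightarrow> nat \<Rightarrow> (nat \<Rightarrow> 'a) \<Rightarrow> bool" where
  "glr_rule f0 f1 f2 I w C k x \<longleftrightarrow> (\<exists>(v1, v2)\<in>I k.
    w k v1 v2 * (\<Prod>j\<in>{v1..<v2}. f1 (x j) / f0 (x j)) * (\<Prod>j\<in>{v2..k}. f2 (x j) / f0 (x j)) \<in> C)"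

text \<open>Only finitely many pairs occur at time \<open>k\<close>, and their products involve
  observations \<open>1\<close> to \<open>k\<close> only. A pair on the shifted path has the same
  value as the pair moved by \<open>m\<close> on the original path.\<close>

lemma alarm_rule_glr:
  assumes f [measurable]: "f0 \<in> borel_measurable \<mu>" "f1 \<in> borel_measurable \<mu>" "f2 \<in> borel_measurable \<mu>"
    and C [measurable]: "C \<in> sets borel"
    and I: "\<And>k v1 v2. (v1, v2) \<in> I k \<Longrightarrow> 1 \<le> v1 \<and> v1 \<le> v2 \<and> v2 \<le> k + 1"
    and I_shift: "\<And>k v1 v2 m. (v1, v2) \<in> I k \<Longrightarrow> (v1 + m, v2 + m) \<in> I (k + m)"
    and w_shift: "\<And>k v1 v2 m. w (k + m) (v1 + m) (v2 + m) = w k v1 v2"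
  shows "alarm_rule \<mu> (glr_rule f0 f1 f2 I w C)"
proof
  fix k :: nat and x :: "nat \<Rightarrow> 'a" assume k: "1 \<le> k"
  let ?L = "\<lambda>v1 v2 x. w k v1 v2 * (\<Prod>j\<in>{v1..<v2}. f1 (x j) / f0 (x j)) * (\<Prod>j\<in>{v2..k}. f2 (x j) / f0 (x j))"
  let ?M = "PiM {1..k} (\<lambda>_. \<mu>)"
  have "finite (I k)"
    by (rule finite_subset[of _ "{1..k + 1} \<times> {1..k + 1}"]) (use I in fastforce)+
  moreover have "Measurable.pred ?M (\<lambda>x. ?L v1 v2 x \<in> C)" if "(v1, v2) \<in> I k" for v1 v2
  proof -
    have comp: "(\<lambda>x. g (x j)) \<in> borel_measurable ?M"
      if "g \<in> borel_measurable \<mu>" "j \<in> {1..k}" for g :: "'a \<Rightarrow> real" and j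
      by (rule measurable_compose[OF measurable_component_singleton[OF that(2), of "\<lambda>_. \<mu>"] that(1)])
    have "?L v1 v2 \<in> borel_measurable ?M"
      by (intro borel_measurable_times borel_measurable_const borel_measurable_prod
          borel_measurable_divide comp f) (use I[OF that] in auto)
    then show ?thesis by simp
  qed
  ultimately show "Measurable.pred ?M (glr_rule f0 f1 f2 I w C k)"
    unfolding glr_rule_def[abs_def] by (intro pred_intros_finite) auto
  have "?L v1 v2 (restrict x {1..k}) = ?L v1 v2 x" if "(v1, v2) \<in> I k" for v1 v2
    using I[OF that] by (intro arg_cong2[where f="(*)"] prod.cong refl) auto
  then show "glr_rule f0 f1 f2 I w C k (restrict x {1..k}) = glr_rule f0 f1 f2 I w C k x"
    unfolding glr_rule_def by (intro bex_cong refl, clarify) (simp only: prod.case)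
  fix m assume "glr_rule f0 f1 f2 I w C k (\<lambda>j. x (j + m))"
  then obtain v1 v2 where v: "(v1, v2) \<in> I k" "?L v1 v2 (\<lambda>j. x (j + m)) \<in> C"
    unfolding glr_rule_def by auto
  then have "w (k + m) (v1 + m) (v2 + m) * (\<Prod>j\<in>{v1 + m..<v2 + m}. f1 (x j) / f0 (x j)) *
      (\<Prod>j\<in>{v2 + m..k + m}. f2 (x j) / f0 (x j)) \<in> C"
    unfolding w_shift prod.shift_bounds_nat_ivl prod.shift_bounds_cl_nat_ivl by simp
  then show "glr_rule f0 f1 f2 I w C (k + m) x"
    unfolding glr_rule_def using I_shift[OF v(1)] by blast
qed

lemma elog_ge_iff: "ereal b \<le> elog y \<longleftrightarrow> exp b \<le> y"
  using exp_gt_zero[of b] by (auto simp: elog_def ln_ge_iff not_le simp del: exp_gt_zero)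

lemma elog_gt_iff: "ereal b < elog y \<longleftrightarrow> exp b < y"
proof (cases "0 < y")
  case True
  have "b < ln y \<longleftrightarrow> exp b < exp (ln y)" by simp
  then show ?thesis using True by (simp add: elog_def)
next
  case False
  then show ?thesis using less_trans[OF exp_gt_zero[of b], of y] by (auto simp: elog_def)
qed

lemma Max_image_ge_iff:
  "finite S \<Longrightarrow> S \<noteq> {} \<Longrightarrow> a \<le> (MAX p\<in>S. F p) \<longleftrightarrow> (\<exists>p\<in>S. a \<le> F p)"
  for F :: "'p \<Rightarrow> 'q::linorder"
  by (subst Max_ge_iff) auto

definition dcusum_pairs :: "nat \<Rightarrow> (nat \<times> nat) set" where
  "dcusum_pairs k = {(v1, v2). 1 \<le> v1 \<and> v1 \<le> k \<and> v1 \<le> v2 \<and> v2 \<le> k + 1}"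

definition wdcusum_pairs :: "nat \<Rightarrow> (nat \<times> nat) set" where
  "wdcusum_pairs k = {(v1, v2). 1 \<le> v1 \<and> v1 \<le> v2 \<and> v2 \<le> k + 1}"

text \<open>The factors \<open>1 - \<rho>\<close> of the transient product are collected into one
  power. Only the order and the differences of the three times enter, whence invariance under
  shifts.\<close>

definition wdcusum_weight :: "real \<Rightarrow> nat \<Rightarrow> nat \<Rightarrow> nat \<Rightarrow> real" where
  "wdcusum_weight \<rho> k v1 v2 = \<rho> ^ (if v2 \<le> k then 1 else 0) * (1 - \<rho>) ^ (v2 - v1)"

lemma dcusum_time_eq:
  "dcusum_time f0 f1 f2 X b \<omega> =
    first_time (glr_rule f0 f1 f2 dcusum_pairs (\<lambda>_ _ _. 1) {exp b<..}) (\<lambda>j. X j \<omega>)"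
proof -
  \<comment> \<open>For \<open>1 \<le> k\<close> the nested maxima range over nonempty sets, so
    exceeding \<open>b\<close> means that some pair exceeds it.\<close>
  have "ereal b < dcusum_stat f0 f1 f2 x k \<longleftrightarrow> glr_rule f0 f1 f2 dcusum_pairs (\<lambda>_ _ _. 1) {exp b<..} k x"
    if "1 \<le> k" for x k
    using that unfolding dcusum_stat_def glr_rule_def dcusum_pairs_def
    by (subst Max_gr_iff; (subst Max_gr_iff)?) (fastforce simp: elog_gt_iff Max_gr_iff)+
  then show ?thesis unfolding dcusum_time_def first_time_def by (auto intro!: arg_cong[where f="Inf"])
qed

lemma wdcusum_time_eq:
  "wdcusum_time f0 f1 f2 \<rho> X b \<omega> =
    first_time (glr_rule f0 f1 f2 wdcusum_pairs (wdcusum_weight \<rho>) {exp b..}) (\<lambda>j. X j \<omega>)"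
proof -
  have "ereal b \<le> wdcusum_stat_pos f0 f1 f2 \<rho> x k \<longleftrightarrow>
      glr_rule f0 f1 f2 wdcusum_pairs (wdcusum_weight \<rho>) {exp b..} k x" for x k
  proof -
    have "finite (wdcusum_pairs k)"
      by (rule finite_subset[of _ "{1..k + 1} \<times> {1..k + 1}"]) (auto simp: wdcusum_pairs_def)
    moreover have "wdcusum_pairs k \<noteq> {}"
      unfolding wdcusum_pairs_def by fastforce
    moreover have "(\<Prod>j\<in>{v1..<v2}. (1 - \<rho>) * f1 (x j) / f0 (x j)) =
        (1 - \<rho>) ^ (v2 - v1) * (\<Prod>j\<in>{v1..<v2}. f1 (x j) / f0 (x j))" for v1 v2
      by (simp add: times_divide_eq_right[symmetric] prod.distrib del: times_divide_eq_right)
    moreover from this have "(ereal b \<le> (case p of (v1, v2) \<Rightarrow> elog (\<rho> ^ (if v2 \<le> k then 1 else 0)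
          * (\<Prod>j\<in>{v1..<v2}. (1 - \<rho>) * f1 (x j) / f0 (x j)) * (\<Prod>j\<in>{v2..k}. f2 (x j) / f0 (x j)))))
      \<longleftrightarrow> (case p of (v1, v2) \<Rightarrow> wdcusum_weight \<rho> k v1 v2
          * (\<Prod>j\<in>{v1..<v2}. f1 (x j) / f0 (x j)) * (\<Prod>j\<in>{v2..k}. f2 (x j) / f0 (x j)) \<in> {exp b..})" for p
      by (cases p) (simp only: elog_ge_iff wdcusum_weight_def mult.assoc atLeast_iff prod.case)
    ultimately show ?thesis
      unfolding wdcusum_stat_pos_def glr_rule_def wdcusum_pairs_def[symmetric]
      by (simp only: Max_image_ge_iff not_False_eq_True)
  qed
  then show ?thesis unfolding wdcusum_time_def first_time_def by simp
qed

subsection \<open>Asymptotics of the delay\<close>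

text \<open>Passes from a bound for each fixed \<open>e\<close> to a single error function, for
  which the relative excess of \<open>J\<close> over the target serves.\<close>

lemma asymp_upper_boundI:
  fixes J :: "real \<Rightarrow> ennreal"
  assumes G: "0 < G" and J: "\<And>e. 0 < e \<Longrightarrow> \<forall>\<^sub>F b in at_top. J b \<le> ennreal (b * (G + e))"
  shows "asymp_upper_bound J (\<lambda>b. b * G)"
  unfolding asymp_upper_bound_def
proof (intro exI conjI)
  \<comment> \<open>The maximum with 0 makes the lower half of the convergence trivial.\<close>
  let ?\<epsilon> = "\<lambda>b. max 0 (enn2real (J b) / (b * G) - 1)"
  show "(?\<epsilon> \<longlongrightarrow> 0) at_top"
  proof (rule order_tendstoI)
    fix a :: real assume "0 < a"
    then have "0 < G * a / 2" using G by simp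
    from J[OF this] eventually_gt_at_top[of 0] show "\<forall>\<^sub>F b in at_top. ?\<epsilon> b < a"
    proof eventually_elim
      case (elim b)
      have "enn2real (J b) \<le> b * (G + G * a / 2)"
        using elim G \<open>0 < a\<close> by (intro enn2real_leI) auto
      then have "enn2real (J b) / (b * G) - 1 \<le> a / 2"
        using elim G by (simp add: field_simps)
      then have "enn2real (J b) / (b * G) - 1 < a" using \<open>0 < a\<close> by linarith
      then show ?case using \<open>0 < a\<close> by linarith
    qed
  qed (auto intro: always_eventually simp: less_max_iff_disj)
  \<comment> \<open>The bound with \<open>e = 1\<close> makes \<open>J b\<close> eventually finite,
    so that \<open>enn2real\<close> loses nothing.\<close>
  from J[OF zero_less_one] eventually_gt_at_top[of 0]
  show "\<forall>\<^sub>F b in at_top. J b \<le> ennreal (b * G * (1 + ?\<epsilon> b))"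
  proof (eventually_elim, simp)
    case (elim b)
    then have "J b = ennreal (enn2real (J b))"
      by (intro ennreal_enn2real[symmetric]) (auto simp: less_top[symmetric] top_unique)
    also have "\<dots> \<le> ennreal (b * G * (1 + ?\<epsilon> b))"
    proof (rule ennreal_leI)
      have "enn2real (J b) = b * G * (1 + (enn2real (J b) / (b * G) - 1))"
        using elim G by simp
      also have "\<dots> \<le> b * G * (1 + ?\<epsilon> b)"
        using elim G by (intro mult_left_mono) auto
      finally show "enn2real (J b) \<le> b * G * (1 + ?\<epsilon> b)" .
    qed
    finally show ?case .
  qed
qed

text \<open>The right-hand side is the expected log-likelihood accumulated by time \<open>N\<close>, when the drift is \<open>a1\<close>
  up to time \<open>d\<close> and \<open>a2\<close> afterwards.\<close>

lemma drift_crossing_time: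
  fixes y a1 a2 :: real and d :: nat
  assumes a: "0 < a1" "0 < a2" and y: "0 \<le> y"
  obtains N where "y \<le> real (min N d) * a1 + real (N - d) * a2"
    and "real N \<le> 1 + min (real d) (y / a1) + (y - min (real d) (y / a1) * a1) / a2"
proof -
  \<comment> \<open>\<open>?D\<close> is the time spent under the first drift, and
    \<open>y - ?D * a1\<close> is left to the second. Rounding the crossing time \<open>?x\<close>
    up costs the 1 in the bound.\<close>
  let ?D = "min (real d) (y / a1)"
  let ?x = "?D + (y - ?D * a1) / a2"
  let ?N = "nat \<lceil>?x\<rceil>"
  have D: "0 \<le> ?D" "?D * a1 \<le> y" using a y by (auto simp: field_simps min_def)
  then have x: "0 \<le> (y - ?D * a1) / a2" "0 \<le> ?x" using a by auto
  have N: "?x \<le> real ?N" "real ?N \<le> ?x + 1"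
    using x by linarith+
  show thesis
  proof
    show "real ?N \<le> 1 + ?D + (y - ?D * a1) / a2" using N by simp
    show "y \<le> real (min ?N d) * a1 + real (?N - d) * a2"
    proof (cases "real d \<le> y / a1")
      case True
      then have D_eq: "?D = real d" by simp
      then have "d \<le> ?N" using N(1) x(1) by linarith
      moreover have "(y - real d * a1) / a2 \<le> real ?N - real d" using N(1) D_eq by simp
      ultimately show ?thesis using a by (simp add: field_simps of_nat_diff)
    next
      case False
      then have D_eq: "?D = y / a1" by simp
      then have x_eq: "?x = y / a1" using a by simp
      have "?N \<le> d" using False unfolding x_eq by (simp add: nat_le_iff ceiling_le_iff)
      moreover have "y / a1 \<le> real ?N" using N(1) x_eq by simp
      ultimately show ?thesis using a by (simp add: field_simps)
    qed
  qed
qed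

context transient_change_model
begin

abbreviation "I1 \<equiv> info_number \<mu> f1 f0"
abbreviation "I2 \<equiv> info_number \<mu> f2 f0"

text \<open>The maximum includes the true phases: with \<open>v1 = 1\<close> and
  \<open>v2 = min n d + 1\<close> the products form the true likelihood ratio. For
  \<open>n \<le> d\<close> the second product is empty.\<close>

lemma glr_rule_alarm:
  assumes "(1, min n d + 1) \<in> I n" "w n 1 (min n d + 1) * exp (\<Sum>j\<in>{1..n}. ln (lr d j (x j))) \<in> C"
    and pos: "\<forall>j\<in>{1..n}. 0 < lr d j (x j)"
  shows "glr_rule f0 f1 f2 I w C n x"
proof -
  let ?v = "min n d + 1"
  have "exp (\<Sum>j\<in>{1..n}. ln (lr d j (x j))) = (\<Prod>j\<in>{1..n}. lr d j (x j))"
    using pos by (simp add: exp_sum)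
  also have "\<dots> = (\<Prod>j\<in>{1..<?v} \<union> {?v..n}. lr d j (x j))"
    by (intro prod.cong) auto
  also have "\<dots> = (\<Prod>j\<in>{1..<?v}. lr d j (x j)) * (\<Prod>j\<in>{?v..n}. lr d j (x j))"
    by (intro prod.union_disjoint) auto
  also have "\<dots> = (\<Prod>j\<in>{1..<?v}. f1 (x j) / f0 (x j)) * (\<Prod>j\<in>{?v..n}. f2 (x j) / f0 (x j))"
    by (intro arg_cong2[where f="(*)"] prod.cong) (auto simp: lr_def)
  finally show ?thesis
    unfolding glr_rule_def using assms(1,2) by (auto simp: mult.assoc intro!: bexI[of _ "(1, ?v)"])
qed

text \<open>The level in \<open>alarm\<close> allows for the weights and fits both procedures.
  \<open>\<gamma>\<close> is the asymptotic share of \<open>b\<close> gained in the transient phase,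
  so both cases of the theorem are treated at once. The drifts are lowered slightly and the level is
  raised to \<open>(1 + \<eta>) * b\<close>; then \<open>b\<close> tends to infinity for fixed
  \<open>\<eta>\<close>.\<close>

lemma delay_asymptotics:
  fixes A :: "real \<Rightarrow> nat \<Rightarrow> (nat \<Rightarrow> 'a) \<Rightarrow> bool" and c :: ereal
  assumes rule: "\<And>b. 0 < b \<Longrightarrow> alarm_rule \<mu> (A b)"
    and alarm: "\<And>b n x. 0 < b \<Longrightarrow> 1 \<le> n \<Longrightarrow> (\<forall>j\<in>{1..n}. 0 < lr (d b) j (x j)) \<Longrightarrow>
      b - ln (\<rho> b) - real (min n (d b)) * ln (1 - \<rho> b) < (\<Sum>j\<in>{1..n}. ln (lr (d b) j (x j))) \<Longrightarrow> A b n x"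
    and \<rho>: "(\<rho> \<longlongrightarrow> 0) at_top" "((\<lambda>b. ln (\<rho> b) / b) \<longlongrightarrow> 0) at_top"
    and c: "0 \<le> c" "((\<lambda>b. ereal (real (d b) * I1 / b)) \<longlongrightarrow> c) at_top"
    and \<gamma>: "\<gamma> = real_of_ereal (min c 1)"
  shows "asymp_upper_bound (\<lambda>b. pollak_delay (P (d b)) (\<lambda>\<omega>. first_time (A b) (\<lambda>j. X j \<omega>)))
    (\<lambda>b. b * (\<gamma> / I1 + (1 - \<gamma>) / I2))"
proof (rule asymp_upper_boundI)
  let ?G = "\<gamma> / I1 + (1 - \<gamma>) / I2"
  have I: "0 < I1" "0 < I2" using info_pos by auto
  have "0 \<le> \<gamma>" "\<gamma> \<le> 1"
    using c(1) unfolding \<gamma> by (cases c; auto simp: min_def)+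
  show "0 < ?G"
  proof (cases "\<gamma> = 0")
    case False
    then have "0 < \<gamma> / I1" using \<open>0 \<le> \<gamma>\<close> I by simp
    moreover have "0 \<le> (1 - \<gamma>) / I2" using \<open>\<gamma> \<le> 1\<close> I by simp
    ultimately show ?thesis by simp
  qed (use I in simp)
  fix e :: real assume e: "0 < e"
  \<comment> \<open>One \<open>\<eta>\<close> is lost in \<open>exp_moment\<close>; the second one
    in \<open>a1\<close> pays for \<open>ln (1 - \<rho> b)\<close> at each transient
    observation.\<close>
  define a1 where "a1 \<eta> = I1 - 2 * \<eta>" for \<eta>
  define a2 where "a2 \<eta> = I2 - \<eta>" for \<eta>
  \<comment> \<open>In units of \<open>b / I1\<close>, \<open>K\<close> is the time in which drift
    \<open>a1\<close> alone reaches the raised level, and \<open>\<Gamma>\<close> the limit of the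
    transient time used before crossing.\<close>
  define K where "K \<eta> = (1 + \<eta>) * I1 / a1 \<eta>" for \<eta>
  define \<Gamma> where "\<Gamma> \<eta> = real_of_ereal (min c (ereal (K \<eta>)))" for \<eta>
  have \<Gamma>_bounds: "\<gamma> \<le> \<Gamma> \<eta> \<and> \<Gamma> \<eta> \<le> \<gamma> * K \<eta>" if "1 \<le> K \<eta>" for \<eta>
  proof (cases "c \<le> 1")
    case True
    then obtain c' where "c = ereal c'" "0 \<le> c'" "c' \<le> 1" using c(1) by (cases c) auto
    then show ?thesis
      using that mult_left_mono[OF that, of c'] by (simp add: \<gamma> \<Gamma>_def min_def one_ereal_def)
  next
    case False
    then show ?thesis using that by (cases c) (auto simp: \<gamma> \<Gamma>_def min_def one_ereal_def)
  qed
  have a_lim: "(a1 \<longlongrightarrow> I1) (at_right 0)" "(a2 \<longlongrightarrow> I2) (at_right 0)"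
    unfolding a1_def[abs_def] a2_def[abs_def] by (auto intro!: tendsto_eq_intros)
  have K_lim: "(K \<longlongrightarrow> 1) (at_right 0)"
    unfolding K_def[abs_def] using I by (auto intro!: tendsto_eq_intros a_lim)
  have a_pos: "\<forall>\<^sub>F \<eta> in at_right 0. 0 < a1 \<eta> \<and> 0 < a2 \<eta> \<and> 0 < \<eta>"
    using order_tendstoD(1)[OF a_lim(1) I(1)] order_tendstoD(1)[OF a_lim(2) I(2)]
    by (intro eventually_conj) (auto simp: eventually_at_filter)
  have K_ge: "1 \<le> K \<eta>" if "0 < a1 \<eta>" "0 < \<eta>" for \<eta>
  proof -
    have "0 \<le> \<eta> * I1" using that I by simp
    then show ?thesis using that unfolding K_def by (simp add: a1_def field_simps)
  qed
  have "(\<Gamma> \<longlongrightarrow> \<gamma>) (at_right 0)"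
  proof (rule tendsto_sandwich[where f="\<lambda>_. \<gamma>" and h="\<lambda>\<eta>. \<gamma> * K \<eta>"])
    show "((\<lambda>\<eta>. \<gamma> * K \<eta>) \<longlongrightarrow> \<gamma>) (at_right 0)"
      using tendsto_mult_left[OF K_lim, of \<gamma>] by simp
    show "\<forall>\<^sub>F \<eta> in at_right 0. \<gamma> \<le> \<Gamma> \<eta>"
      using a_pos by eventually_elim (use K_ge \<Gamma>_bounds in blast)
    show "\<forall>\<^sub>F \<eta> in at_right 0. \<Gamma> \<eta> \<le> \<gamma> * K \<eta>"
      using a_pos by eventually_elim (use K_ge \<Gamma>_bounds in blast)
  qed simp
  \<comment> \<open>The crossing time divided by \<open>b\<close>: transient time
    \<open>\<Gamma> \<eta> / I1\<close>, plus the remaining level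
    \<open>1 + \<eta> - \<Gamma> \<eta> * a1 \<eta> / I1\<close> divided by
    \<open>a2 \<eta>\<close>.\<close>
  then have "((\<lambda>\<eta>. \<Gamma> \<eta> / I1 * (1 - a1 \<eta> / a2 \<eta>) + (1 + \<eta>) / a2 \<eta>) \<longlongrightarrow>
      \<gamma> / I1 * (1 - I1 / I2) + (1 + 0) / I2) (at_right 0)"
    using I by (intro tendsto_intros a_lim) auto
  moreover have "\<gamma> / I1 * (1 - I1 / I2) + (1 + 0) / I2 < ?G + e"
    using I e by (simp add: field_simps)
  ultimately have "\<forall>\<^sub>F \<eta> in at_right 0. \<Gamma> \<eta> / I1 * (1 - a1 \<eta> / a2 \<eta>) + (1 + \<eta>) / a2 \<eta> < ?G + e"
    by (rule order_tendstoD(2))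
  then have "\<forall>\<^sub>F \<eta> in at_right 0. \<Gamma> \<eta> / I1 * (1 - a1 \<eta> / a2 \<eta>) + (1 + \<eta>) / a2 \<eta> < ?G + e
      \<and> 0 < a1 \<eta> \<and> 0 < a2 \<eta> \<and> 0 < \<eta>"
    using a_pos by (rule eventually_conj)
  then obtain \<eta> where \<eta>: "\<Gamma> \<eta> / I1 * (1 - a1 \<eta> / a2 \<eta>) + (1 + \<eta>) / a2 \<eta> < ?G + e"
    and pos: "0 < a1 \<eta>" "0 < a2 \<eta>" "0 < \<eta>"
    using eventually_happens'[OF trivial_limit_at_right_real] by blast
  have "\<forall>\<^sub>F n in sequentially.
    (\<integral>\<^sup>+x. ennreal (f1 x * exp (- (inverse (real (Suc n)) * ln (f1 x / f0 x)))) \<partial>\<mu>)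
      \<le> ennreal (exp (- (inverse (real (Suc n)) * (I1 - \<eta>)))) \<and>
    (\<integral>\<^sup>+x. ennreal (f2 x * exp (- (inverse (real (Suc n)) * ln (f2 x / f0 x)))) \<partial>\<mu>)
      \<le> ennreal (exp (- (inverse (real (Suc n)) * (I2 - \<eta>))))"
    using pos by (intro eventually_conj exp_moment) auto
  then obtain n where
    "(\<integral>\<^sup>+x. ennreal (f1 x * exp (- (inverse (real (Suc n)) * ln (f1 x / f0 x)))) \<partial>\<mu>)
      \<le> ennreal (exp (- (inverse (real (Suc n)) * (I1 - \<eta>))))"
    "(\<integral>\<^sup>+x. ennreal (f2 x * exp (- (inverse (real (Suc n)) * ln (f2 x / f0 x)))) \<partial>\<mu>)
      \<le> ennreal (exp (- (inverse (real (Suc n)) * (I2 - \<eta>))))"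
    using eventually_happens'[OF sequentially_bot] by blast
  then obtain s where s: "0 < s"
    and m1: "(\<integral>\<^sup>+x. ennreal (f1 x * exp (- (s * ln (f1 x / f0 x)))) \<partial>\<mu>) \<le> ennreal (exp (- (s * (a1 \<eta> + \<eta>))))"
    and m2: "(\<integral>\<^sup>+x. ennreal (f2 x * exp (- (s * ln (f2 x / f0 x)))) \<partial>\<mu>) \<le> ennreal (exp (- (s * a2 \<eta>)))"
    by (intro that[of "inverse (real (Suc n))"]) (auto simp: a1_def a2_def)
  \<comment> \<open>The geometric tail does not depend on \<open>b\<close>, since \<open>s\<close>
    and \<open>\<eta>\<close> are fixed; it disappears after division by \<open>b\<close>.\<close>
  define R where "R = 1 / (1 - exp (- (s * min (a1 \<eta>) (a2 \<eta>))))"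
  define r where "r b = min (real (d b) * I1 / b) (K \<eta>)" for b
  \<comment> \<open>Truncation at \<open>K \<eta>\<close> in \<open>ereal\<close> makes the limit
    finite even for \<open>c = \<infinity>\<close>.\<close>
  have "((\<lambda>b. min (ereal (real (d b) * I1 / b)) (ereal (K \<eta>))) \<longlongrightarrow> min c (ereal (K \<eta>))) at_top"
    by (intro tendsto_min c tendsto_const)
  moreover have "min c (ereal (K \<eta>)) = ereal (\<Gamma> \<eta>)"
    using c(1) unfolding \<Gamma>_def by (cases c) (auto simp: min_def)
  ultimately have r_lim: "(r \<longlongrightarrow> \<Gamma> \<eta>) at_top"
    unfolding r_def[abs_def] by (simp add: ereal_min[symmetric] del: ereal_min)
  have "((\<lambda>b. r b / I1 * (1 - a1 \<eta> / a2 \<eta>) + (1 + \<eta>) / a2 \<eta> + (1 + R) / b) \<longlongrightarrow>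
      \<Gamma> \<eta> / I1 * (1 - a1 \<eta> / a2 \<eta>) + (1 + \<eta>) / a2 \<eta> + 0) at_top"
    using I pos by (intro tendsto_intros r_lim real_tendsto_divide_at_top[OF tendsto_const] filterlim_ident) auto
  then have "\<forall>\<^sub>F b in at_top. r b / I1 * (1 - a1 \<eta> / a2 \<eta>) + (1 + \<eta>) / a2 \<eta> + (1 + R) / b < ?G + e"
    using \<eta> by (intro order_tendstoD(2)) auto
  moreover have "\<forall>\<^sub>F b in at_top. - \<eta> < ln (\<rho> b) / b"
    using pos by (intro order_tendstoD(1)[OF \<rho>(2)]) auto
  moreover have "((\<lambda>b. ln (1 - \<rho> b)) \<longlongrightarrow> ln (1 - 0)) at_top"
    by (intro tendsto_intros \<rho>(1)) auto
  then have "\<forall>\<^sub>F b in at_top. - \<eta> < ln (1 - \<rho> b)"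
    using pos by (intro order_tendstoD(1)) auto
  ultimately show "\<forall>\<^sub>F b in at_top.
    pollak_delay (P (d b)) (\<lambda>\<omega>. first_time (A b) (\<lambda>j. X j \<omega>)) \<le> ennreal (b * (?G + e))"
    using eventually_gt_at_top[of 0]
  proof eventually_elim
    case (elim b)
    then have b: "0 < b" by simp
    interpret alarm_model \<Omega> \<mu> f0 f1 f2 P X "A b"
      by (intro alarm_model.intro transient_change_model_axioms rule b)
    let ?y = "(1 + \<eta>) * b"
    let ?D = "min (real (d b)) (?y / a1 \<eta>)"
    have D: "?D = r b * b / I1"
    proof -
      have "r b * (b / I1) = min (real (d b) * I1 / b * (b / I1)) (K \<eta> * (b / I1))"
        using b I unfolding r_def min_mult_distrib_right by simp
      moreover have "real (d b) * I1 / b * (b / I1) = real (d b)" "K \<eta> * (b / I1) = ?y / a1 \<eta>"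
        using b I pos by (simp_all add: K_def)
      ultimately show ?thesis by simp
    qed
    obtain N where N: "?y \<le> real (min N (d b)) * a1 \<eta> + real (N - d b) * a2 \<eta>"
      and N_le: "real N \<le> 1 + ?D + (?y - ?D * a1 \<eta>) / a2 \<eta>"
      using drift_crossing_time[OF pos(1,2), of ?y "d b"] b pos(3) by auto
    have "pollak_delay (P (d b)) (\<lambda>\<omega>. first_time (A b) (\<lambda>j. X j \<omega>)) = worst_delay (d b)"
      using pollak_delay_eq[of "d b"] by (simp add: \<tau>_def[abs_def])
    also have "\<dots> \<le> ennreal (real N + R)"
      unfolding R_def
    proof (rule worst_delay_le[OF s pos(1,2) less_imp_le[OF pos(3)] m1 m2 _ N])
      fix n x assume n: "1 \<le> n" "\<forall>j\<in>{1..n}. 0 < lr (d b) j (x j)"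
        and sum: "?y + real (min n (d b)) * \<eta> < (\<Sum>j\<in>{1..n}. ln (lr (d b) j (x j)))"
      \<comment> \<open>The weight \<open>\<rho>\<close> is absorbed by the raised level, the powers
        of \<open>1 - \<rho>\<close> by the slack \<open>\<kappa> = \<eta>\<close>.\<close>
      have "- ln (\<rho> b) \<le> \<eta> * b" using elim b by (simp add: field_simps)
      moreover have "real (min n (d b)) * - ln (1 - \<rho> b) \<le> real (min n (d b)) * \<eta>"
        using elim by (intro mult_left_mono) auto
      ultimately have "b - ln (\<rho> b) - real (min n (d b)) * ln (1 - \<rho> b) < (\<Sum>j\<in>{1..n}. ln (lr (d b) j (x j)))"
        using sum by (simp add: algebra_simps)
      then show "A b n x" by (rule alarm[OF b n])
    qed
    also have "\<dots> \<le> ennreal (b * (?G + e))"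
    proof (rule ennreal_leI)
      have "real N + R \<le> 1 + ?D + (?y - ?D * a1 \<eta>) / a2 \<eta> + R" using N_le by simp
      also have "\<dots> = b * (r b / I1 * (1 - a1 \<eta> / a2 \<eta>) + (1 + \<eta>) / a2 \<eta> + (1 + R) / b)"
        unfolding D using b I pos by (simp add: field_simps)
      also have "\<dots> \<le> b * (?G + e)" using elim b by (intro mult_left_mono) auto
      finally show "real N + R \<le> b * (?G + e)" .
    qed
    finally show ?case .
  qed
qed

section \<open>Application to the D-CuSum and WD-CuSum procedures\<close>

lemma alarm_model_dcusum:
  "alarm_model \<Omega> \<mu> f0 f1 f2 P X (glr_rule f0 f1 f2 dcusum_pairs (\<lambda>_ _ _. 1) {exp b<..})"
  by (intro alarm_model.intro transient_change_model_axioms alarm_rule_glr measurable_densities)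
     (auto simp: dcusum_pairs_def)

lemma alarm_model_wdcusum:
  "alarm_model \<Omega> \<mu> f0 f1 f2 P X (glr_rule f0 f1 f2 wdcusum_pairs (wdcusum_weight \<rho>) {exp b..})"
  by (intro alarm_model.intro transient_change_model_axioms alarm_rule_glr measurable_densities)
     (auto simp: wdcusum_pairs_def wdcusum_weight_def)

lemma lorden_eq_pollak:
  assumes "alarm_model \<Omega> \<mu> f0 f1 f2 P X A"
  shows "lorden_delay \<mu> X (P d) (\<lambda>\<omega>. first_time A (\<lambda>j. X j \<omega>)) =
    pollak_delay (P d) (\<lambda>\<omega>. first_time A (\<lambda>j. X j \<omega>))"
proof -
  interpret alarm_model \<Omega> \<mu> f0 f1 f2 P X A by (rule assms)
  show ?thesis using lorden_delay_eq[of d] pollak_delay_eq[of d] by (simp add: \<tau>_def[abs_def])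
qed

text \<open>Both logarithms are nonpositive, so the weight terms only raise the level above
  \<open>b\<close> and the unweighted statistic crosses as well.\<close>

lemma dcusum_alarm:
  assumes "0 < \<rho>" "\<rho> < 1" "1 \<le> n" "\<forall>j\<in>{1..n}. 0 < lr d j (x j)"
    and "b - ln \<rho> - real (min n d) * ln (1 - \<rho>) < (\<Sum>j\<in>{1..n}. ln (lr d j (x j)))"
  shows "glr_rule f0 f1 f2 dcusum_pairs (\<lambda>_ _ _. 1) {exp b<..} n x"
proof (rule glr_rule_alarm[where d=d])
  have "ln \<rho> \<le> 0" "real (min n d) * ln (1 - \<rho>) \<le> 0"
    using assms(1,2) by (auto intro!: mult_nonneg_nonpos)
  then show "1 * exp (\<Sum>j\<in>{1..n}. ln (lr d j (x j))) \<in> {exp b<..}"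
    using assms(5) by simp
qed (use assms in \<open>auto simp: dcusum_pairs_def\<close>)

lemma wdcusum_alarm:
  assumes "0 < \<rho>" "\<rho> < 1" "1 \<le> n" "\<forall>j\<in>{1..n}. 0 < lr d j (x j)"
    and "b - ln \<rho> - real (min n d) * ln (1 - \<rho>) < (\<Sum>j\<in>{1..n}. ln (lr d j (x j)))"
  shows "glr_rule f0 f1 f2 wdcusum_pairs (wdcusum_weight \<rho>) {exp b..} n x"
proof (rule glr_rule_alarm[where d=d])
  let ?S = "\<Sum>j\<in>{1..n}. ln (lr d j (x j))"
  have "exp b \<le> exp (ln \<rho> + real (min n d) * ln (1 - \<rho>) + ?S)"
    using assms(5) by simp
  also have "\<dots> = \<rho> * (1 - \<rho>) ^ min n d * exp ?S"
    using assms(1,2) by (simp only: exp_add exp_of_nat_mult exp_ln diff_gt_0_iff_gt)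
  \<comment> \<open>Equality holds for \<open>n > d\<close>; for \<open>n \<le> d\<close> the weight
    lacks the factor \<open>\<rho> < 1\<close> and is larger.\<close>
  also have "\<dots> \<le> wdcusum_weight \<rho> n 1 (min n d + 1) * exp ?S"
    using assms(1,2) by (intro mult_right_mono) (auto simp: wdcusum_weight_def mult_le_cancel_right1)
  finally show "wdcusum_weight \<rho> n 1 (min n d + 1) * exp ?S \<in> {exp b..}" by simp
qed (use assms in \<open>auto simp: wdcusum_pairs_def\<close>)

end

theorem theorem3:
  fixes \<Omega> :: "'w measure"
    and \<mu> :: "'a measure"
    and f0 f1 f2 :: "'a \<Rightarrow> real"
    and P :: "nat \<Rightarrow> nat \<Rightarrow> 'w measure"
    and X :: "nat \<Rightarrow> 'w \<Rightarrow> 'a"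
    and \<rho> :: "real \<Rightarrow> real"
    and d :: "real \<Rightarrow> nat"
    and c :: ereal
  defines "I1 \<equiv> info_number \<mu> f1 f0"
    and "I2 \<equiv> info_number \<mu> f2 f0"
    and "WD \<equiv> \<lambda>b. wdcusum_time f0 f1 f2 (\<rho> b) X b"
    and "DC \<equiv> \<lambda>b. dcusum_time f0 f1 f2 X b"
    and "JL \<equiv> \<lambda>b \<tau>. lorden_delay \<mu> X (P (d b)) \<tau>"
    and "JP \<equiv> \<lambda>b \<tau>. pollak_delay (P (d b)) \<tau>"
  assumes "transient_change_model \<Omega> \<mu> f0 f1 f2 P X"
    and "\<And>b. b > 0 \<Longrightarrow> 0 < \<rho> b \<and> \<rho> b < 1"
    and "(\<rho> \<longlongrightarrow> 0) at_top"
    and "((\<lambda>b. ln (\<rho> b) / b) \<longlongrightarrow> 0) at_top"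
    and "filterlim d at_top at_top"
    and "0 \<le> c"
    and "((\<lambda>b. ereal (real (d b) * I1 / b)) \<longlongrightarrow> c) at_top"
  shows "(c > 1 \<longrightarrow>
      (\<forall>b>0. JL b (WD b) = JP b (WD b)) \<and>
      asymp_upper_bound (\<lambda>b. JP b (WD b)) (\<lambda>b. b / I1) \<and>
      (\<forall>b>0. JL b (DC b) = JP b (DC b)) \<and>
      asymp_upper_bound (\<lambda>b. JP b (DC b)) (\<lambda>b. b / I1))
      \<and> (c \<le> 1 \<longrightarrow>
      (\<forall>b>0. JL b (WD b) = JP b (WD b)) \<and>
      asymp_upper_bound (\<lambda>b. JP b (WD b))
        (\<lambda>b. b * (real_of_ereal c / I1 + (1 - real_of_ereal c) / I2)) \<and>
      (\<forall>b>0. JL b (DC b) = JP b (DC b)) \<and>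
      asymp_upper_bound (\<lambda>b. JP b (DC b))
        (\<lambda>b. b * (real_of_ereal c / I1 + (1 - real_of_ereal c) / I2)))"
proof -
  interpret transient_change_model \<Omega> \<mu> f0 f1 f2 P X by (rule assms)
  \<comment> \<open>Truncation at 1 merges the cases: \<open>\<gamma> = 1\<close> leaves
    \<open>1 / I1\<close>, otherwise \<open>\<gamma>\<close> is \<open>c\<close> itself.\<close>
  define \<gamma> where "\<gamma> = real_of_ereal (min c 1)"
  let ?G = "\<lambda>b. b * (\<gamma> / I1 + (1 - \<gamma>) / I2)"
  let ?W = "\<lambda>b. glr_rule f0 f1 f2 wdcusum_pairs (wdcusum_weight (\<rho> b)) {exp b..}"
  let ?C = "\<lambda>b. glr_rule f0 f1 f2 dcusum_pairs (\<lambda>_ _ _. 1) {exp b<..}"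
  have WD: "WD b = (\<lambda>\<omega>. first_time (?W b) (\<lambda>j. X j \<omega>))"
    and DC: "DC b = (\<lambda>\<omega>. first_time (?C b) (\<lambda>j. X j \<omega>))" for b
    unfolding WD_def DC_def by (simp_all add: fun_eq_iff wdcusum_time_eq dcusum_time_eq)
  have eq: "JL b (WD b) = JP b (WD b)" "JL b (DC b) = JP b (DC b)" for b
    unfolding JL_def JP_def WD DC
    by (rule lorden_eq_pollak alarm_model_wdcusum alarm_model_dcusum)+
  have W: "asymp_upper_bound (\<lambda>b. JP b (WD b)) ?G"
    unfolding JP_def WD I1_def I2_def
  proof (rule delay_asymptotics)
    show "alarm_rule \<mu> (?W b)" for b
      using alarm_model_wdcusum by (rule alarm_model.axioms(2))
    show "?W b n x" if "0 < b" "1 \<le> n" "\<forall>j\<in>{1..n}. 0 < lr (d b) j (x j)"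
      "b - ln (\<rho> b) - real (min n (d b)) * ln (1 - \<rho> b) < (\<Sum>j\<in>{1..n}. ln (lr (d b) j (x j)))" for b n x
      using assms(8)[OF that(1)] that(2-4) by (intro wdcusum_alarm) auto
  qed (use assms in \<open>simp_all add: \<gamma>_def\<close>)
  have C: "asymp_upper_bound (\<lambda>b. JP b (DC b)) ?G"
    unfolding JP_def DC I1_def I2_def
  proof (rule delay_asymptotics)
    show "alarm_rule \<mu> (?C b)" for b
      using alarm_model_dcusum by (rule alarm_model.axioms(2))
    show "?C b n x" if "0 < b" "1 \<le> n" "\<forall>j\<in>{1..n}. 0 < lr (d b) j (x j)"
      "b - ln (\<rho> b) - real (min n (d b)) * ln (1 - \<rho> b) < (\<Sum>j\<in>{1..n}. ln (lr (d b) j (x j)))" for b n x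
      using assms(8)[OF that(1)] that(2-4) by (intro dcusum_alarm[of "\<rho> b"]) auto
  qed (use assms in \<open>simp_all add: \<gamma>_def\<close>)
  have "\<gamma> = 1" if "1 < c" using that by (simp add: \<gamma>_def min_def)
  moreover have "\<gamma> = real_of_ereal c" if "c \<le> 1" using that by (simp add: \<gamma>_def min_def)
  ultimately show ?thesis using eq W C by auto
qed

end
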